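(* Let $\alpha\in(0,\infty)$ and $p\in[1,\infty)$ satisfy $2\le\alpha p<2p+1$, and set $\sigma=(\alpha p-1)/(2p)$. Let $f:\mathbb{R}/\mathcal{L}\mathbb{Z}\to\mathbb{R}^n$ be an arclength parametrization of a closed curve without self-intersections, with $\tau=f'$, let $f$ be bi-Lipschitz, and let $f,\phi,\psi\in W^{1+\sigma,2p}(\mathbb{R}/\mathcal{L}\mathbb{Z},\mathbb{R}^n)\cap W^{1,\infty}(\mathbb{R}/\mathcal{L}\mathbb{Z},\mathbb{R}^n)$. Then $\mathscr{G}_{(\alpha,p)}(f)[\phi]$ and $\mathscr{H}_{(\alpha,p)}(f)[\phi,\psi]$ can be written as $$\mathscr{G}_{(\alpha,p)}(f)[\phi]=\sum_{i=1}^2\mathscr{G}_i(f)[\phi],\qquad \mathscr{H}_{(\alpha,p)}(f)[\phi,\psi]=\sum_{i=1}^6\mathscr{H}_i(f)[\phi,\psi],$$ where $$\begin{aligned} \mathscr{G}_1(f)[\phi]&=p(\mathscr{M}_\alpha(f))^{p-1}\,\delta\mathscr{M}_\alpha(f)[\phi],\\ \mathscr{G}_2(f)[\phi]&=(\mathscr{M}_\alpha(f))^p\,(\tau(s_1)\cdot\phi'(s_1)+\tau(s_2)\cdot\phi'(s_2)),\\ \mathscr{H}_1(f)[\phi,\psi]&=p(\mathscr{M}_\alpha(f))^{p-1}\,\delta^2\mathscr{M}_\alpha(f)[\phi,\psi],\\ \mathscr{H}_2(f)[\phi,\psi]&=p(p-1)(\mathscr{M}_\alpha(f))^{p-2}\,\delta\mathscr{M}_\alpha(f)[\phi]\,\delta\mathscr{M}_\alpha(f)[\psi],\\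 \mathscr{H}_3(f)[\phi,\psi]&=\mathscr{G}_1(f)[\phi]\,(\tau(s_1)\cdot\psi'(s_1)+\tau(s_2)\cdot\psi'(s_2)),\\ \mathscr{H}_4(f)[\phi,\psi]&=\mathscr{G}_1(f)[\psi]\,(\tau(s_1)\cdot\phi'(s_1)+\tau(s_2)\cdot\phi'(s_2)),\\ \mathscr{H}_5(f)[\phi,\psi]&=(\mathscr{M}_\alpha(f))^p\{\phi'(s_1)\cdot\psi'(s_1)+\phi'(s_2)\cdot\psi'(s_2)\\ &\quad-2(\tau(s_1)\cdot\phi'(s_1))(\tau(s_1)\cdot\psi'(s_1))-2(\tau(s_2)\cdot\phi'(s_2))(\tau(s_2)\cdot\psi'(s_2))\},\\ \mathscr{H}_6(f)[\phi,\psi]&=(\mathscr{M}_\alpha(f))^p(\tau(s_1)\cdot\phi'(s_1)+\tau(s_2)\cdot\phi'(s_2))(\tau(s_1)\cdot\psi'(s_1)+\tau(s_2)\cdot\psi'(s_2)). \end{aligned}$$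
   Context: $\mathcal{L}>0$ is the length of the curve. $\Delta u=u(s_1)-u(s_2)$, $\Delta^3_4u=u(s_3)-u(s_4)$, $\Delta s=s_1-s_2$, and $|\Delta s|$ is the distance in $\mathbb{R}/\mathcal{L}\mathbb{Z}$. $\mathscr{D}(f)=\mathscr{D}(f(s_1),f(s_2))$ is the intrinsic distance between the two points along the curve (length of the shorter arc). $f$ is bi-Lipschitz if $\mathscr{D}(f)\le C_{\mathrm b}\|\Delta f\|_{\mathbb{R}^n}$ for some constant $C_{\mathrm b}>0$. The integrals $\int_{s_2}^{s_1}$ below are along the shorter arc. For $0<\sigma<1$ and $q\ge1$, $W^{1+\sigma,q}(\mathbb{R}/\mathcal{L}\mathbb{Z},\mathbb{R}^n)$ is the Sobolev–Slobodeckij space of $u\in W^{1,q}$ with $\iint_{(\mathbb{R}/\mathcal{L}\mathbb{Z})^2}\|\Delta u'\|_{\mathbb{R}^n}^q\,|\Delta s|^{-1-\sigma q}\,ds_1ds_2<\infty$. $$\mathscr{M}_{(\alpha,p)}(f)=\left(\frac1{\|\Delta f\|_{\mathbb{R}^n}^\alpha}-\frac1{\mathscr{D}(f)^\alpha}\right)^p,\qquad \mathscr{M}_\alpha(f)=\frac{\varphi_\alpha(\mathscr{N}(\tau))}{\|\Delta f\|_{\mathbb{R}^n}^\alpha},\qquad \varphi_\alpha(t)=1-\frac1{(1+t)^{\alpha/2}},$$ $$\mathscr{N}(\tau)=\frac1{2\|\Delta f\|_{\mathbb{R}^n}^2}\int_{s_2}^{s_1}\int_{s_2}^{s_1}\|\Delta_4^3\tau\|_{\mathbb{R}^n}^2\,ds_3ds_4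 .$$ One has $\mathscr{M}_{(\alpha,p)}(f)=(\mathscr{M}_\alpha(f))^p$. For a geometric quantity $\mathscr{F}(f)$ of the closed curve, $\delta\mathscr{F}(f)[\phi]=\frac{d}{d\varepsilon}\mathscr{F}(f+\varepsilon\phi)|_{\varepsilon=0}$ and $\delta^2\mathscr{F}(f)[\phi,\psi]=\frac{\partial^2}{\partial\varepsilon_1\partial\varepsilon_2}\mathscr{F}(f+\varepsilon_1\phi+\varepsilon_2\psi)|_{\varepsilon_1=\varepsilon_2=0}$. On a perturbed curve $g$, every occurrence of the curve is perturbed: distances are those of $g$, the unit tangent is $g'/\|g'\|$, and each line element $ds_j$ becomes $\|g'(s_j)\|\,ds_j$ (so that $\delta(ds_j)[\phi]=\tau(s_j)\cdot\phi'(s_j)\,ds_j$). The first and second variational formulae, as functions of $(s_1,s_2)$, are defined by $$\mathscr{G}_{(\alpha,p)}(f)[\phi]\,ds_1ds_2=\delta(\mathscr{M}_{(\alpha,p)}(f)\,ds_1ds_2)[\phi],\qquad \mathscr{H}_{(\alpha,p)}(f)[\phi,\psi]\,ds_1ds_2=\delta^2(\mathscr{M}_{(\alpha,p)}(f)\,ds_1ds_2)[\phi,\psi].$$ *)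

theory Defs
  imports "HOL-Analysis.Analysis"
begin

text \<open>
  Maps on the circle of length \<open>L\<close> are \<open>L\<close>-periodic maps on the reals; the circle with its
  Lebesgue measure is the half-open interval \<open>{0..<L}\<close>.
\<close>

definition periodic :: "real \<Rightarrow> (real \<Rightarrow> 'b) \<Rightarrow> bool" where
  "periodic L u \<longleftrightarrow> (\<forall>s. u (s + L) = u s)"

abbreviation circle :: "real \<Rightarrow> real measure" where
  "circle L \<equiv> lebesgue_on {0..<L}"

definition circle_dist :: "real \<Rightarrow> real \<Rightarrow> real \<Rightarrow> real" where
  "circle_dist L s t = (INF k::int. \<bar>s - t + of_int k * L\<bar>)"


section \<open>Sobolev spaces on the circle\<close>

definition test_fun :: "real \<Rightarrow> (real \<Rightarrow> real) \<Rightarrow> bool" where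
  "test_fun L \<eta> \<longleftrightarrow> periodic L \<eta> \<and> (\<forall>k s. (deriv ^^ k) \<eta> field_differentiable (at s))"

definition weak_deriv :: "real \<Rightarrow> (real \<Rightarrow> real ^ 'n) \<Rightarrow> (real \<Rightarrow> real ^ 'n) \<Rightarrow> bool" where
  "weak_deriv L u v \<longleftrightarrow> integrable (circle L) v \<and>
     (\<forall>\<eta>. test_fun L \<eta> \<longrightarrow>
        (\<integral>s. deriv \<eta> s *\<^sub>R u s \<partial>circle L) = - (\<integral>s. \<eta> s *\<^sub>R v s \<partial>circle L))"

text \<open>
  In one dimension every class in the first-order Sobolev spaces has a unique continuous
  representative; the spaces below consist of these representatives. Continuity and periodicity
  of \<open>u\<close> put \<open>u\<close> itself into every Lebesgue space of the circle.
\<close>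

definition sobolev_slobodeckij :: "real \<Rightarrow> real \<Rightarrow> real \<Rightarrow> (real \<Rightarrow> real ^ 'n) set" where
  "sobolev_slobodeckij L \<sigma> q = {u. continuous_on UNIV u \<and> periodic L u \<and>
     (\<exists>v. weak_deriv L u v \<and> integrable (circle L) (\<lambda>s. norm (v s) powr q) \<and>
        (\<integral>\<^sup>+ s\<^sub>1. \<integral>\<^sup>+ s\<^sub>2. ennreal (norm (v s\<^sub>1 - v s\<^sub>2) powr q
             * circle_dist L s\<^sub>1 s\<^sub>2 powr (-1 - \<sigma> * q)) \<partial>circle L \<partial>circle L) < \<infinity>)}"

definition sobolev_inf :: "real \<Rightarrow> (real \<Rightarrow> real ^ 'n) set" where
  "sobolev_inf L = {u. continuous_on UNIV u \<and> periodic L u \<and>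
     (\<exists>v C. weak_deriv L u v \<and> (AE s in circle L. norm (v s) \<le> C))}"


section \<open>Geometry of a closed curve\<close>

text \<open>
  For the curves considered here the classical derivative exists almost everywhere, so \<open>velocity\<close>
  is meaningful almost everywhere; at points where all the functions involved are differentiable
  it is linear in the curve.
\<close>

definition velocity :: "(real \<Rightarrow> real ^ 'n) \<Rightarrow> real \<Rightarrow> real ^ 'n" where
  "velocity g s = vector_derivative g (at s)"

definition tangent :: "(real \<Rightarrow> real ^ 'n) \<Rightarrow> real \<Rightarrow> real ^ 'n" where
  "tangent g s = velocity g s /\<^sub>R norm (velocity g s)"

definition line_elt :: "(real \<Rightarrow> real ^ 'n) \<Rightarrow> real \<Rightarrow> real" where
  "line_elt g s = norm (velocity g s)"

text \<open>The parameter interval traversed when moving from \<open>a\<close> in positive direction to the first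
  point congruent to \<open>b\<close> modulo \<open>L\<close>.\<close>

definition pos_arc :: "real \<Rightarrow> real \<Rightarrow> real \<Rightarrow> real set" where
  "pos_arc L a b = {a .. a + L * frac ((b - a) / L)}"

definition arc_length :: "(real \<Rightarrow> real ^ 'n) \<Rightarrow> real set \<Rightarrow> real" where
  "arc_length g A = (LINT s:A|lebesgue. line_elt g s)"

definition intrinsic_dist :: "real \<Rightarrow> (real \<Rightarrow> real ^ 'n) \<Rightarrow> real \<Rightarrow> real \<Rightarrow> real" where
  "intrinsic_dist L g s\<^sub>1 s\<^sub>2 = min (arc_length g (pos_arc L s\<^sub>2 s\<^sub>1)) (arc_length g (pos_arc L s\<^sub>1 s\<^sub>2))"

definition short_arc :: "real \<Rightarrow> (real \<Rightarrow> real ^ 'n) \<Rightarrow> real \<Rightarrow> real \<Rightarrow> real set" where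
  "short_arc L g s\<^sub>1 s\<^sub>2 =
     (if arc_length g (pos_arc L s\<^sub>2 s\<^sub>1) \<le> arc_length g (pos_arc L s\<^sub>1 s\<^sub>2) then pos_arc L s\<^sub>2 s\<^sub>1 else pos_arc L s\<^sub>1 s\<^sub>2)"

text \<open>An almost everywhere unit derivative characterises arclength only for absolutely continuous
  curves; it is used here together with membership in \<open>sobolev_inf\<close>.\<close>

definition arclength_param :: "real \<Rightarrow> (real \<Rightarrow> real ^ 'n) \<Rightarrow> bool" where
  "arclength_param L f \<longleftrightarrow> periodic L f \<and> continuous_on UNIV f \<and>
     (AE s in lebesgue. \<exists>t. (f has_vector_derivative t) (at s) \<and> norm t = 1)"

definition non_self_intersecting :: "real \<Rightarrow> (real \<Rightarrow> real ^ 'n) \<Rightarrow> bool" where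
  "non_self_intersecting L f \<longleftrightarrow> inj_on f {0..<L}"

definition bi_Lipschitz :: "real \<Rightarrow> (real \<Rightarrow> real ^ 'n) \<Rightarrow> bool" where
  "bi_Lipschitz L f \<longleftrightarrow>
     (\<exists>C>0. \<forall>s\<^sub>1 s\<^sub>2. intrinsic_dist L f s\<^sub>1 s\<^sub>2 \<le> C * norm (f s\<^sub>1 - f s\<^sub>2))"


section \<open>Energy densities\<close>

definition M_ap :: "real \<Rightarrow> real \<Rightarrow> real \<Rightarrow> (real \<Rightarrow> real ^ 'n) \<Rightarrow> real \<Rightarrow> real \<Rightarrow> real" where
  "M_ap L \<alpha> p g s\<^sub>1 s\<^sub>2 =
     (1 / norm (g s\<^sub>1 - g s\<^sub>2) powr \<alpha> - 1 / intrinsic_dist L g s\<^sub>1 s\<^sub>2 powr \<alpha>) powr p"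

text \<open>Both integrals in \<open>N_tau\<close> have the same orientation, so the sign from the orientation of the
  arc cancels.\<close>

definition N_tau :: "real \<Rightarrow> (real \<Rightarrow> real ^ 'n) \<Rightarrow> real \<Rightarrow> real \<Rightarrow> real" where
  "N_tau L g s\<^sub>1 s\<^sub>2 = 1 / (2 * (norm (g s\<^sub>1 - g s\<^sub>2))\<^sup>2) *
     (LINT s\<^sub>3:short_arc L g s\<^sub>1 s\<^sub>2|lebesgue. LINT s\<^sub>4:short_arc L g s\<^sub>1 s\<^sub>2|lebesgue.
        (norm (tangent g s\<^sub>3 - tangent g s\<^sub>4))\<^sup>2 * line_elt g s\<^sub>3 * line_elt g s\<^sub>4)"

definition phi_a :: "real \<Rightarrow> real \<Rightarrow> real" where
  "phi_a \<alpha> t = 1 - 1 / (1 + t) powr (\<alpha> / 2)"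

definition M_a :: "real \<Rightarrow> real \<Rightarrow> (real \<Rightarrow> real ^ 'n) \<Rightarrow> real \<Rightarrow> real \<Rightarrow> real" where
  "M_a L \<alpha> g s\<^sub>1 s\<^sub>2 = phi_a \<alpha> (N_tau L g s\<^sub>1 s\<^sub>2) / norm (g s\<^sub>1 - g s\<^sub>2) powr \<alpha>"

definition M_density :: "real \<Rightarrow> real \<Rightarrow> real \<Rightarrow> (real \<Rightarrow> real ^ 'n) \<Rightarrow> real \<Rightarrow> real \<Rightarrow> real" where
  "M_density L \<alpha> p g s\<^sub>1 s\<^sub>2 = M_ap L \<alpha> p g s\<^sub>1 s\<^sub>2 * line_elt g s\<^sub>1 * line_elt g s\<^sub>2"

text \<open>Powers with the convention \<open>0 ^ 0 = 1\<close>, which the formulas need at points where \<open>M_a\<close> vanishes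
  (the curve is straight along the arc), whereas \<open>0 powr 0 = 0\<close>.\<close>

definition rpow :: "real \<Rightarrow> real \<Rightarrow> real" where
  "rpow x a = (if a = 0 then 1 else x powr a)"


section \<open>Variations\<close>

definition has_var1 :: "((real \<Rightarrow> real ^ 'n) \<Rightarrow> real) \<Rightarrow> (real \<Rightarrow> real ^ 'n) \<Rightarrow> (real \<Rightarrow> real ^ 'n) \<Rightarrow> bool"
where
  "has_var1 F f \<phi> \<longleftrightarrow> (\<lambda>\<epsilon>. F (\<lambda>s. f s + \<epsilon> *\<^sub>R \<phi> s)) field_differentiable (at 0)"

definition var1 :: "((real \<Rightarrow> real ^ 'n) \<Rightarrow> real) \<Rightarrow> (real \<Rightarrow> real ^ 'n) \<Rightarrow> (real \<Rightarrow> real ^ 'n) \<Rightarrow> real"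
where
  "var1 F f \<phi> = deriv (\<lambda>\<epsilon>. F (\<lambda>s. f s + \<epsilon> *\<^sub>R \<phi> s)) 0"

definition has_var2 ::
  "((real \<Rightarrow> real ^ 'n) \<Rightarrow> real) \<Rightarrow> (real \<Rightarrow> real ^ 'n) \<Rightarrow> (real \<Rightarrow> real ^ 'n) \<Rightarrow> (real \<Rightarrow> real ^ 'n) \<Rightarrow> bool"
where
  "has_var2 F f \<phi> \<psi> \<longleftrightarrow>
     (\<forall>\<^sub>F \<epsilon>\<^sub>1 in nhds 0.
        (\<lambda>\<epsilon>\<^sub>2. F (\<lambda>s. f s + \<epsilon>\<^sub>1 *\<^sub>R \<phi> s + \<epsilon>\<^sub>2 *\<^sub>R \<psi> s)) field_differentiable (at 0)) \<and>
     (\<lambda>\<epsilon>\<^sub>1. deriv (\<lambda>\<epsilon>\<^sub>2. F (\<lambda>s. f s + \<epsilon>\<^sub>1 *\<^sub>R \<phi> s + \<epsilon>\<^sub>2 *\<^sub>R \<psi> s)) 0) field_differentiable (at 0)"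

definition var2 ::
  "((real \<Rightarrow> real ^ 'n) \<Rightarrow> real) \<Rightarrow> (real \<Rightarrow> real ^ 'n) \<Rightarrow> (real \<Rightarrow> real ^ 'n) \<Rightarrow> (real \<Rightarrow> real ^ 'n) \<Rightarrow> real"
where
  "var2 F f \<phi> \<psi> =
     deriv (\<lambda>\<epsilon>\<^sub>1. deriv (\<lambda>\<epsilon>\<^sub>2. F (\<lambda>s. f s + \<epsilon>\<^sub>1 *\<^sub>R \<phi> s + \<epsilon>\<^sub>2 *\<^sub>R \<psi> s)) 0) 0"

definition G_ap where
  "G_ap L \<alpha> p f \<phi> s\<^sub>1 s\<^sub>2 = var1 (\<lambda>g. M_density L \<alpha> p g s\<^sub>1 s\<^sub>2) f \<phi>"

definition H_ap where
  "H_ap L \<alpha> p f \<phi> \<psi> s\<^sub>1 s\<^sub>2 = var2 (\<lambda>g. M_density L \<alpha> p g s\<^sub>1 s\<^sub>2) f \<phi> \<psi>"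

definition dM_a where
  "dM_a L \<alpha> f \<phi> s\<^sub>1 s\<^sub>2 = var1 (\<lambda>g. M_a L \<alpha> g s\<^sub>1 s\<^sub>2) f \<phi>"

definition ddM_a where
  "ddM_a L \<alpha> f \<phi> \<psi> s\<^sub>1 s\<^sub>2 = var2 (\<lambda>g. M_a L \<alpha> g s\<^sub>1 s\<^sub>2) f \<phi> \<psi>"

text \<open>The unit tangent of the unperturbed, arclength parametrised curve is its velocity.\<close>

definition dline where
  "dline f \<phi> s\<^sub>1 s\<^sub>2 = velocity f s\<^sub>1 \<bullet> velocity \<phi> s\<^sub>1 + velocity f s\<^sub>2 \<bullet> velocity \<phi> s\<^sub>2"

definition G1 where
  "G1 L \<alpha> p f \<phi> s\<^sub>1 s\<^sub>2 = p * rpow (M_a L \<alpha> f s\<^sub>1 s\<^sub>2) (p - 1) * dM_a L \<alpha> f \<phi> s\<^sub>1 s\<^sub>2"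

definition G2 where
  "G2 L \<alpha> p f \<phi> s\<^sub>1 s\<^sub>2 = rpow (M_a L \<alpha> f s\<^sub>1 s\<^sub>2) p * dline f \<phi> s\<^sub>1 s\<^sub>2"

definition H1 where
  "H1 L \<alpha> p f \<phi> \<psi> s\<^sub>1 s\<^sub>2 = p * rpow (M_a L \<alpha> f s\<^sub>1 s\<^sub>2) (p - 1) * ddM_a L \<alpha> f \<phi> \<psi> s\<^sub>1 s\<^sub>2"

text \<open>Where \<open>M_a\<close> vanishes and \<open>p < 2\<close>, the negative power is 0 by convention. There \<open>M_a\<close> is minimal,
  so both first variations vanish and the product is 0 for any value of the power.\<close>

definition H2 where
  "H2 L \<alpha> p f \<phi> \<psi> s\<^sub>1 s\<^sub>2 = p * (p - 1) * rpow (M_a L \<alpha> f s\<^sub>1 s\<^sub>2) (p - 2)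
     * dM_a L \<alpha> f \<phi> s\<^sub>1 s\<^sub>2 * dM_a L \<alpha> f \<psi> s\<^sub>1 s\<^sub>2"

definition H3 where
  "H3 L \<alpha> p f \<phi> \<psi> s\<^sub>1 s\<^sub>2 = G1 L \<alpha> p f \<phi> s\<^sub>1 s\<^sub>2 * dline f \<psi> s\<^sub>1 s\<^sub>2"

definition H4 where
  "H4 L \<alpha> p f \<phi> \<psi> s\<^sub>1 s\<^sub>2 = G1 L \<alpha> p f \<psi> s\<^sub>1 s\<^sub>2 * dline f \<phi> s\<^sub>1 s\<^sub>2"

definition H5 where
  "H5 L \<alpha> p f \<phi> \<psi> s\<^sub>1 s\<^sub>2 = rpow (M_a L \<alpha> f s\<^sub>1 s\<^sub>2) p *
     (velocity \<phi> s\<^sub>1 \<bullet> velocity \<psi> s\<^sub>1 + velocity \<phi> s\<^sub>2 \<bullet> velocity \<psi> s\<^sub>2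
      - 2 * (velocity f s\<^sub>1 \<bullet> velocity \<phi> s\<^sub>1) * (velocity f s\<^sub>1 \<bullet> velocity \<psi> s\<^sub>1)
      - 2 * (velocity f s\<^sub>2 \<bullet> velocity \<phi> s\<^sub>2) * (velocity f s\<^sub>2 \<bullet> velocity \<psi> s\<^sub>2))"

definition H6 where
  "H6 L \<alpha> p f \<phi> \<psi> s\<^sub>1 s\<^sub>2 =
     rpow (M_a L \<alpha> f s\<^sub>1 s\<^sub>2) p * dline f \<phi> s\<^sub>1 s\<^sub>2 * dline f \<psi> s\<^sub>1 s\<^sub>2"

end

theory Submission
  imports Defs
begin

text \<open>
  A loop with bounded weak derivative is Lipschitz: testing the weak derivative with primitives of the
  kernels \<open>(1 + cos (2 * pi * x / L)) ^ n\<close> gives the fundamental theorem of calculus, and Lebesgue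
  differentiation gives a classical derivative almost everywhere. Fix two parameters at which
  everything is differentiable and whose difference is not a multiple of \<open>L / 2\<close>. The two
  arcs between them have different lengths, so the short arc is the same for all small perturbations
  \<open>g\<close>. Expanding the square in \<open>N_tau\<close> gives \<open>1 + N_tau = D\<^sup>2 / d\<^sup>2\<close>, where \<open>d\<close> is the chord and \<open>D\<close> the
  arc, whence \<open>M_a = 1 / d powr \<alpha> - 1 / D powr \<alpha> \<ge> 0\<close>; both \<open>d\<close> and \<open>D\<close> can be
  differentiated twice in the perturbation parameters, \<open>D\<close> by dominated convergence. The formulas are
  then the chain and product rules for \<open>M_a powr p\<close> times the line elements. Where \<open>M_a\<close> vanishes
  it is minimal, so its first variations vanish and \<open>p \<ge> 1\<close> suffices for the chain rule.
\<close>

section \<open>Trigonometric kernels\<close>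

text \<open>The hypotheses give weak derivatives on one period, while \<open>velocity\<close> is the
  classical derivative of a loop on the whole line; the two have to be identified, also across
  multiples of \<open>L\<close>. Test functions must be periodic and infinitely differentiable.
  Integrating a normalised kernel \<open>k (t - s)\<close> over \<open>t\<close> in
  \<open>{a..b}\<close> yields such a function of \<open>s\<close>: it approximates the indicator of
  \<open>{a..b}\<close>, and its derivative approximates the point mass at \<open>a\<close> minus
  the one at \<open>b\<close>. For \<open>1 < p < 2\<close> the power \<open>t powr p\<close> has no
  second derivative at 0, yet the second variation exists where \<open>M_a\<close> vanishes: the
  first variation of \<open>M_a\<close> vanishes there too, so the difference quotient of
  \<open>M_a powr (p - 1)\<close> times that variation is a factor tending to 0 times a convergent
  quotient. The formulas are stated through the variations of \<open>M_a\<close>, so only the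
  existence of these variations has to be proved; their values stay abstract throughout.\<close>

inductive trig_poly :: "real \<Rightarrow> (real \<Rightarrow> real) \<Rightarrow> bool" for c where
  const: "trig_poly c (\<lambda>_. a)"
| sin: "trig_poly c (\<lambda>s. sin (c * s))"
| cos: "trig_poly c (\<lambda>s. cos (c * s))"
| add: "trig_poly c f \<Longrightarrow> trig_poly c g \<Longrightarrow> trig_poly c (\<lambda>s. f s + g s)"
| mult: "trig_poly c f \<Longrightarrow> trig_poly c g \<Longrightarrow> trig_poly c (\<lambda>s. f s * g s)"

lemma trig_poly_cmult: "trig_poly c f \<Longrightarrow> trig_poly c (\<lambda>s. a * f s)"
  by (rule trig_poly.mult[OF trig_poly.const])

lemma trig_poly_power: "trig_poly c f \<Longrightarrow> trig_poly c (\<lambda>s. f s ^ n)"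
  by (induction n) (auto intro: trig_poly.intros)

text \<open>The derivative stays in the class because the class is closed under sums and products at
  a fixed frequency \<open>c\<close>. All iterated derivatives required by \<open>test_fun\<close>
  are then reached by a single induction.\<close>

lemma trig_poly_has_derivative:
  "trig_poly c f \<Longrightarrow> \<exists>g. trig_poly c g \<and> (\<forall>s. (f has_real_derivative g s) (at s))"
proof (induction rule: trig_poly.induct)
  case (const a)
  then show ?case by (intro exI[of _ "\<lambda>_. 0"]) (auto intro: trig_poly.const)
next
  case sin
  show ?case
    by (rule exI[of _ "\<lambda>s. c * cos (c * s)"])
       (auto intro!: trig_poly_cmult trig_poly.cos derivative_eq_intros)
next
  case cos
  show ?case
    by (rule exI[of _ "\<lambda>s. (- c) * sin (c * s)"])
       (auto intro!: trig_poly_cmult[where a = "- c", simplified] trig_poly.sin derivative_eq_intros)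
next
  case (add f g)
  then obtain f' g' where "trig_poly c f'" "\<forall>s. (f has_real_derivative f' s) (at s)"
    "trig_poly c g'" "\<forall>s. (g has_real_derivative g' s) (at s)" by blast
  then show ?case
    by (intro exI[of _ "\<lambda>s. f' s + g' s"]) (auto intro!: trig_poly.add derivative_eq_intros)
next
  case (mult f g)
  then obtain f' g' where "trig_poly c f'" "\<forall>s. (f has_real_derivative f' s) (at s)"
    "trig_poly c g'" "\<forall>s. (g has_real_derivative g' s) (at s)" by blast
  with mult.hyps show ?case
    by (intro exI[of _ "\<lambda>s. f' s * g s + g' s * f s"])
       (auto intro!: trig_poly.add trig_poly.mult derivative_eq_intros)
qed

lemma trig_poly_deriv: "trig_poly c f \<Longrightarrow> trig_poly c (deriv f)"
proof -
  assume "trig_poly c f"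
  then obtain g where g: "trig_poly c g" "\<forall>s. (f has_real_derivative g s) (at s)"
    using trig_poly_has_derivative by blast
  then have "deriv f = g" by (auto intro!: DERIV_imp_deriv)
  with g show ?thesis by simp
qed

lemma trig_poly_differentiable: "trig_poly c f \<Longrightarrow> f field_differentiable (at s)"
  using trig_poly_has_derivative field_differentiable_def by blast

lemma trig_poly_higher_deriv:
  "trig_poly c f \<Longrightarrow> (deriv ^^ k) f field_differentiable (at s)"
proof -
  assume f: "trig_poly c f"
  have "trig_poly c ((deriv ^^ k) f)" by (induction k) (auto intro: f trig_poly_deriv)
  then show ?thesis by (rule trig_poly_differentiable)
qed

text \<open>For \<open>0 < L\<close> the base lies between 0 and 1 and equals 1 only at multiples of
  \<open>L\<close>. Its powers, divided by their integral over a period, therefore form an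
  approximate identity made of trigonometric polynomials.\<close>

definition cos_kernel :: "real \<Rightarrow> nat \<Rightarrow> real \<Rightarrow> real" where
  "cos_kernel L n x = ((1 + cos (2 * pi / L * x)) / 2) ^ n"

lemma cos_kernel_nonneg: "0 \<le> cos_kernel L n x"
  unfolding cos_kernel_def by (intro zero_le_power) (simp add: cos_ge_minus_one add.commute real_0_le_add_iff)

lemma cos_kernel_minus: "cos_kernel L n (- x) = cos_kernel L n x"
  by (simp add: cos_kernel_def)

lemma cos_kernel_periodic: "0 < L \<Longrightarrow> cos_kernel L n (x + L) = cos_kernel L n x"
proof -
  assume "0 < L"
  then have "2 * pi / L * (x + L) = 2 * pi / L * x + 2 * pi" by (simp add: field_simps)
  then show ?thesis by (simp add: cos_kernel_def)
qed

lemma continuous_cos_kernel [continuous_intros]: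
  fixes f :: "real \<Rightarrow> real"
  shows "continuous_on A f \<Longrightarrow> continuous_on A (\<lambda>x. cos_kernel L n (f x))"
  unfolding cos_kernel_def
  by (intro continuous_on_power continuous_on_divide continuous_on_add continuous_on_cos
      continuous_on_mult continuous_on_const) auto

text \<open>The addition theorem turns the shifted cosine into a combination of
  \<open>cos (c * s)\<close> and \<open>sin (c * s)\<close> whose coefficients depend on
  \<open>t\<close> only.\<close>

lemma trig_poly_cos_kernel: "trig_poly (2 * pi / L) (\<lambda>s. cos_kernel L n (t - s))"
proof -
  let ?c = "2 * pi / L"
  have "cos_kernel L n (t - s) =
      (1/2 + (1/2 * cos (?c * t)) * cos (?c * s) + (1/2 * sin (?c * t)) * sin (?c * s)) ^ n" for s
    by (simp only: cos_kernel_def right_diff_distrib[of ?c] cos_diff) (simp add: field_simps)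
  then show ?thesis
    by (simp only:) (intro trig_poly_power trig_poly.add trig_poly_cmult trig_poly.intros)
qed

lemma cos_kernel_antiderivative:
  obtains P where "\<And>x. (P has_real_derivative cos_kernel L n x) (at x)"
proof -
  have "\<exists>F. \<forall>x::real. (-\<infinity>) < ereal x \<longrightarrow> ereal x < \<infinity> \<longrightarrow>
      (F has_vector_derivative cos_kernel L n x) (at x)"
    by (rule einterval_antiderivative) (auto intro!: continuous_on_interior[of UNIV] continuous_intros)
  then show ?thesis using that by (auto simp: has_real_derivative_iff_has_vector_derivative)
qed

text \<open>Only differences of values of a primitive occur below, so any primitive of each kernel
  serves and no closed form is needed.\<close>

locale kernel_antideriv =
  fixes L :: real and P :: "nat \<Rightarrow> real \<Rightarrow> real"
  assumes L_pos: "0 < L"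
    and P: "\<And>n x. (P n has_real_derivative cos_kernel L n x) (at x)"
begin

definition mass :: "nat \<Rightarrow> real" where "mass n = P n L - P n 0"

text \<open>The kernel is periodic, so the increment over a period has derivative zero. A primitive
  is thus periodic up to the constant \<open>mass n\<close>, the integral of the kernel over one
  period.\<close>

lemma P_shift: "P n (x + L) = P n x + mass n"
proof -
  have "((\<lambda>x. P n (x + L) - P n x) has_real_derivative cos_kernel L n (x + L) - cos_kernel L n x) (at x)" for x
    by (intro DERIV_diff P DERIV_shift[THEN iffD1])
  then have "((\<lambda>x. P n (x + L) - P n x) has_real_derivative 0) (at x)" for x
    by (simp add: cos_kernel_periodic[OF L_pos])
  from DERIV_isconst_all[OF allI[OF this], of x 0] show ?thesis
    by (simp add: mass_def)
qed

lemma has_integral_cos_kernel: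
  assumes "a \<le> b"
  shows "((\<lambda>t. cos_kernel L n (t - s)) has_integral P n (b - s) - P n (a - s)) {a..b}"
proof (rule fundamental_theorem_of_calculus[OF assms])
  fix t
  have "((\<lambda>t. P n (t - s)) has_real_derivative cos_kernel L n (t - s)) (at t)"
    using DERIV_shift[of "P n" _ t "- s"] P[of n "t - s"] by simp
  then show "((\<lambda>t. P n (t - s)) has_vector_derivative cos_kernel L n (t - s)) (at t within {a..b})"
    by (simp add: has_real_derivative_iff_has_vector_derivative has_vector_derivative_at_within)
qed

lemma P_mono: "x \<le> y \<Longrightarrow> P n x \<le> P n y"
  using DERIV_nonneg_imp_nondecreasing[of x y "P n"] P cos_kernel_nonneg by blast

text \<open>For \<open>a \<le> b\<close> this function is the kernel integrated over
  \<open>{a..b}\<close>. The increments \<open>mass n\<close> of the two primitives cancel, so the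
  difference is periodic although \<open>P n\<close> is not.\<close>

lemma test_fun_P:
  "test_fun L (\<lambda>s. P n (b - s) - P n (a - s))"
  "deriv (\<lambda>s. P n (b - s) - P n (a - s)) = (\<lambda>s. cos_kernel L n (a - s) - cos_kernel L n (b - s))"
proof -
  let ?\<eta> = "\<lambda>s. P n (b - s) - P n (a - s)" and ?d = "\<lambda>s. cos_kernel L n (a - s) + (-1) * cos_kernel L n (b - s)"
  have D: "(?\<eta> has_real_derivative ?d s) (at s)" for s
    by (auto intro!: derivative_eq_intros DERIV_chain2[OF P])
  have tp: "trig_poly (2 * pi / L) ?d"
    by (intro trig_poly.add trig_poly_cmult trig_poly_cos_kernel)
  have d: "deriv ?\<eta> = ?d" using D by (auto intro!: DERIV_imp_deriv)
  then show "deriv ?\<eta> = (\<lambda>s. cos_kernel L n (a - s) - cos_kernel L n (b - s))" by simp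
  have "periodic L ?\<eta>"
    unfolding periodic_def
  proof
    fix s
    show "?\<eta> (s + L) = ?\<eta> s"
      using P_shift[of n "b - (s + L)"] P_shift[of n "a - (s + L)"] by simp
  qed
  \<comment> \<open>Membership in \<open>trig_poly\<close> is established only for the first
    derivative, so the case of no derivative is treated separately.\<close>
  moreover have "(deriv ^^ k) ?\<eta> field_differentiable (at s)" for k s
  proof (cases k)
    case 0
    then show ?thesis using D field_differentiable_def by auto
  next
    case (Suc j)
    have "(deriv ^^ k) ?\<eta> = (deriv ^^ j) ?d" unfolding Suc funpow_Suc_right o_def d ..
    then show ?thesis using trig_poly_higher_deriv[OF tp] by simp
  qed
  ultimately show "test_fun L ?\<eta>" by (auto simp: test_fun_def)
qed

end

text \<open>The half-open and the closed interval differ at most in the point \<open>L\<close>. This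
  links the Bochner integral over the circle with the gauge integral, in which the fundamental
  theorem and Lebesgue differentiation are applied.\<close>

lemma
  fixes f :: "real \<Rightarrow> 'a::euclidean_space"
  shows integrable_circle_iff: "integrable (circle L) f \<longleftrightarrow> f absolutely_integrable_on {0..L}"
    and integral_circle: "integrable (circle L) f \<Longrightarrow> integral\<^sup>L (circle L) f = integral {0..L} f"
proof -
  have "integrable (circle L) f \<longleftrightarrow> f absolutely_integrable_on {0..<L}"
    by (simp add: set_integrable_def integrable_restrict_space)
  also have "\<dots> \<longleftrightarrow> f absolutely_integrable_on {0..L}"
    by (rule absolutely_integrable_spike_set_eq; rule negligible_subset[of "{L}"]; auto)
  finally show "integrable (circle L) f \<longleftrightarrow> f absolutely_integrable_on {0..L}" .
  show "integral\<^sup>L (circle L) f = integral {0..L} f" if "integrable (circle L) f"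
  proof -
    have "(f has_integral integral\<^sup>L (circle L) f) {0..<L}"
      by (rule has_integral_integral_lebesgue_on[OF that]) simp
    then have "(f has_integral integral\<^sup>L (circle L) f) {0..L}"
      by (rule has_integral_spike_set_eq[THEN iffD1, rotated -1])
         (rule negligible_subset[of "{L}"]; auto)+
    then show ?thesis by (simp add: integral_unique)
  qed
qed

section \<open>Concentration of the normalised kernels\<close>

lemma cos_kernel_antimono:
  assumes "0 < L" "0 \<le> x" "x \<le> y" "y \<le> L / 2"
  shows "cos_kernel L n y \<le> cos_kernel L n x"
proof -
  have "2 * pi / L * y \<le> pi"
    using assms by (simp add: field_simps)
  moreover have "2 * pi / L * x \<le> 2 * pi / L * y"
    using assms by (intro mult_left_mono) auto
  ultimately have "cos (2 * pi / L * y) \<le> cos (2 * pi / L * x)"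
    using assms by (intro cos_monotone_0_pi_le) auto
  moreover have "0 \<le> (1 + cos (2 * pi / L * y)) / 2"
    by (simp add: cos_ge_minus_one add.commute real_0_le_add_iff)
  ultimately show ?thesis
    unfolding cos_kernel_def by (intro power_mono) auto
qed

text \<open>Evenness and periodicity fold the argument into the interval from
  \<open>\<delta>\<close> to \<open>L / 2\<close>, on which the kernel decreases.\<close>

lemma cos_kernel_le:
  assumes "0 < L" "0 \<le> \<delta>" "\<delta> \<le> \<bar>x\<bar>" "\<bar>x\<bar> \<le> L - \<delta>"
  shows "cos_kernel L n x \<le> cos_kernel L n \<delta>"
proof -
  have x: "cos_kernel L n x = cos_kernel L n \<bar>x\<bar>"
    by (simp add: abs_if cos_kernel_minus)
  show ?thesis
  proof (cases "\<bar>x\<bar> \<le> L / 2")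
    case True
    then show ?thesis unfolding x using assms by (intro cos_kernel_antimono) auto
  next
    case False
    have "cos_kernel L n \<bar>x\<bar> = cos_kernel L n (\<bar>x\<bar> - L)"
      using cos_kernel_periodic[OF assms(1), of n "\<bar>x\<bar> - L"] by simp
    also have "\<dots> = cos_kernel L n (L - \<bar>x\<bar>)"
      using cos_kernel_minus[of L n "L - \<bar>x\<bar>"] by simp
    also have "\<dots> \<le> cos_kernel L n \<delta>"
      using assms False by (intro cos_kernel_antimono) auto
    finally show ?thesis using x by simp
  qed
qed

context kernel_antideriv
begin

lemma mass_ge:
  assumes "0 < \<delta>" "\<delta> \<le> L / 2"
  shows "\<delta> * cos_kernel L n \<delta> \<le> mass n"
proof -
  have "((\<lambda>t. cos_kernel L n \<delta>) has_integral \<delta> * cos_kernel L n \<delta>) {0..\<delta>}"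
    using has_integral_const_real[of "cos_kernel L n \<delta>" 0 \<delta>] assms by simp
  moreover have "((\<lambda>t. cos_kernel L n t) has_integral P n \<delta> - P n 0) {0..\<delta>}"
    using has_integral_cos_kernel[of 0 \<delta> n 0] assms by simp
  ultimately have "\<delta> * cos_kernel L n \<delta> \<le> P n \<delta> - P n 0"
    by (rule has_integral_le) (use assms L_pos in \<open>auto intro: cos_kernel_antimono\<close>)
  also have "\<dots> \<le> mass n"
    unfolding mass_def using P_mono[of \<delta> L n] assms L_pos by simp
  finally show ?thesis .
qed

lemma cos_kernel_pos: "0 \<le> x \<Longrightarrow> x < L / 2 \<Longrightarrow> 0 < cos_kernel L n x"
proof -
  assume x: "0 \<le> x" "x < L / 2"
  have "cos pi < cos (2 * pi / L * x)"
    using x L_pos by (intro cos_monotone_0_pi) (auto simp: field_simps)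
  then show ?thesis unfolding cos_kernel_def by (intro zero_less_power) auto
qed

lemma mass_pos: "0 < mass n"
proof -
  have "0 < L / 4 * cos_kernel L n (L / 4)"
    using cos_kernel_pos[of "L / 4" n] L_pos by simp
  also have "\<dots> \<le> mass n" using L_pos by (intro mass_ge) auto
  finally show ?thesis .
qed

text \<open>The mass is at least the part of it over \<open>{0..\<delta> / 2}\<close>, where the
  kernel is no smaller than at \<open>\<delta> / 2\<close>. The quotient is therefore bounded by a
  geometric sequence with ratio \<open>q \<delta> / q (\<delta> / 2)\<close>, which is below 1
  because the base strictly decreases.\<close>

lemma cos_kernel_tail:
  assumes \<delta>: "0 < \<delta>" "\<delta> \<le> L / 2"
  shows "(\<lambda>n. cos_kernel L n \<delta> / mass n) \<longlonglongrightarrow> 0"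
proof -
  define q where "q x = (1 + cos (2 * pi / L * x)) / 2" for x
  have k: "cos_kernel L n x = q x ^ n" for n x by (simp add: cos_kernel_def q_def)
  have q0: "0 < q (\<delta> / 2)"
    using cos_kernel_pos[of "\<delta> / 2" 1] \<delta> k[of 1] by simp
  have q1: "0 \<le> q \<delta>" using cos_kernel_nonneg[of L 1 \<delta>] k[of 1] by simp
  have "cos (2 * pi / L * \<delta>) < cos (2 * pi / L * (\<delta> / 2))"
    using \<delta> L_pos by (intro cos_monotone_0_pi) (auto simp: field_simps)
  then have lt: "q \<delta> < q (\<delta> / 2)" by (simp add: q_def)
  have "(\<lambda>n. 2 / \<delta> * (q \<delta> / q (\<delta> / 2)) ^ n) \<longlonglongrightarrow> 2 / \<delta> * 0"
    using q0 q1 lt by (intro tendsto_intros LIMSEQ_realpow_zero) auto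
  then have lim: "(\<lambda>n. 2 / \<delta> * (q \<delta> / q (\<delta> / 2)) ^ n) \<longlonglongrightarrow> 0" by simp
  show ?thesis
  proof (rule tendsto_sandwich[OF _ _ tendsto_const lim])
    show "\<forall>\<^sub>F n in sequentially. 0 \<le> cos_kernel L n \<delta> / mass n"
      by (auto intro!: always_eventually divide_nonneg_pos cos_kernel_nonneg mass_pos)
    have "cos_kernel L n \<delta> / mass n \<le> 2 / \<delta> * (q \<delta> / q (\<delta> / 2)) ^ n" for n
    proof -
      have "cos_kernel L n \<delta> / mass n \<le> cos_kernel L n \<delta> / (\<delta> / 2 * cos_kernel L n (\<delta> / 2))"
        using mass_ge[of "\<delta> / 2" n] \<delta> cos_kernel_nonneg cos_kernel_pos[of "\<delta> / 2" n]
        by (intro divide_left_mono mult_pos_pos mass_pos) auto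
      also have "\<dots> = 2 / \<delta> * (q \<delta> / q (\<delta> / 2)) ^ n"
        unfolding k by (simp add: power_divide)
      finally show ?thesis .
    qed
    then show "\<forall>\<^sub>F n in sequentially. cos_kernel L n \<delta> / mass n \<le> 2 / \<delta> * (q \<delta> / q (\<delta> / 2)) ^ n"
      by simp
  qed
qed

lemma has_integral_normalised_kernel:
  "((\<lambda>t. cos_kernel L n (t - s) / mass n) has_integral 1) {0..L}"
proof -
  have "P n (L - s) - P n (0 - s) = mass n"
    using P_shift[of n "- s"] by simp
  with has_integral_cos_kernel[of 0 L n s] L_pos
  have "((\<lambda>t. cos_kernel L n (t - s)) has_integral mass n) {0..L}" by simp
  from has_integral_divide[OF this, of "mass n"] show ?thesis
    using mass_pos[of n] by simp
qed

text \<open>Since the normalised kernel integrates to 1, the error is the integral of the kernel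
  against \<open>g t - g s\<close>: near \<open>s\<close> continuity makes it small, elsewhere the
  kernel does. Continuity is asked at the single point \<open>s\<close>, so the lemma covers both
  continuous maps and indicators of intervals.\<close>

lemma kernel_convergence:
  fixes g :: "real \<Rightarrow> 'a::euclidean_space"
  assumes int: "\<And>n. (\<lambda>t. (cos_kernel L n (t - s) / mass n) *\<^sub>R g t) integrable_on {0..L}"
    and B: "\<And>t. t \<in> {0..L} \<Longrightarrow> norm (g t) \<le> B"
    and s: "0 < s" "s < L" and cont: "isCont g s"
  shows "(\<lambda>n. integral {0..L} (\<lambda>t. (cos_kernel L n (t - s) / mass n) *\<^sub>R g t)) \<longlonglongrightarrow> g s"
proof (rule LIMSEQ_I)
  fix e :: real assume "0 < e"
  let ?k = "\<lambda>n t. cos_kernel L n (t - s) / mass n"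
  obtain d where d: "0 < d" "\<And>t. dist t s < d \<Longrightarrow> dist (g t) (g s) < e / 2"
    using cont \<open>0 < e\<close> unfolding continuous_at_eps_delta by (metis half_gt_zero)
  \<comment> \<open>The bounds \<open>s\<close> and \<open>L - s\<close> give
    \<open>\<bar>t - s\<bar> \<le> L - \<delta>\<close> for all \<open>t\<close> in
    \<open>{0..L}\<close>, so outside the \<open>\<delta>\<close>-neighbourhood of \<open>s\<close>
    no other peak of the periodic kernel is met.\<close>
  define \<delta> where "\<delta> = min d (min s (L - s))"
  have \<delta>: "0 < \<delta>" "\<delta> \<le> L / 2" "\<delta> \<le> s" "\<delta> \<le> L - s" "\<delta> \<le> d"
    using d(1) s unfolding \<delta>_def by linarith+
  have B0: "0 \<le> B" using order_trans[OF norm_ge_zero B[of 0]] L_pos by simp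
  have "(\<lambda>n. 2 * B * L * (cos_kernel L n \<delta> / mass n)) \<longlonglongrightarrow> 2 * B * L * 0"
    by (intro tendsto_intros cos_kernel_tail \<delta>)
  then have "\<forall>\<^sub>F n in sequentially. 2 * B * L * (cos_kernel L n \<delta> / mass n) < e / 2"
    using \<open>0 < e\<close> by (intro order_tendstoD(2)) auto
  then obtain N where N: "\<And>n. N \<le> n \<Longrightarrow> 2 * B * L * (cos_kernel L n \<delta> / mass n) < e / 2"
    by (auto simp: eventually_sequentially)
  show "\<exists>no. \<forall>n\<ge>no. norm (integral {0..L} (\<lambda>t. ?k n t *\<^sub>R g t) - g s) < e"
  proof (intro exI allI impI)
    fix n assume n: "N \<le> n"
    have knn: "0 \<le> ?k n t" for t using cos_kernel_nonneg mass_pos[of n] by simp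
    have c: "((\<lambda>t. ?k n t *\<^sub>R g s) has_integral g s) {0..L}"
      using has_integral_scaleR_left[OF has_integral_normalised_kernel[where n = n and s = s], of "g s"] by simp
    from has_integral_diff[OF integrable_integral[OF int] c]
    have D: "((\<lambda>t. ?k n t *\<^sub>R (g t - g s)) has_integral
        integral {0..L} (\<lambda>t. ?k n t *\<^sub>R g t) - g s) {0..L}"
      by (simp add: scaleR_diff_right)
    have "((\<lambda>t. e / 2 * ?k n t) has_integral e / 2 * 1) {0..L}"
      by (intro has_integral_mult_right has_integral_normalised_kernel)
    moreover have "((\<lambda>t. 2 * B * (cos_kernel L n \<delta> / mass n)) has_integral
        L * (2 * B * (cos_kernel L n \<delta> / mass n))) {0..L}"
      using has_integral_const_real[of "2 * B * (cos_kernel L n \<delta> / mass n)" 0 L] L_pos by simp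
    ultimately have R: "((\<lambda>t. e / 2 * ?k n t + 2 * B * (cos_kernel L n \<delta> / mass n)) has_integral
        e / 2 * 1 + L * (2 * B * (cos_kernel L n \<delta> / mass n))) {0..L}"
      by (rule has_integral_add)
    have "norm (integral {0..L} (\<lambda>t. ?k n t *\<^sub>R g t) - g s)
        \<le> e / 2 * 1 + L * (2 * B * (cos_kernel L n \<delta> / mass n))"
    proof -
      have bd: "norm (?k n t *\<^sub>R (g t - g s)) \<le> e / 2 * ?k n t + 2 * B * (cos_kernel L n \<delta> / mass n)"
        if t: "t \<in> {0..L}" for t
      proof (cases "\<bar>t - s\<bar> < \<delta>")
        case True
        then have "norm (g t - g s) \<le> e / 2"
          using d(2)[of t] \<delta> by (auto simp: dist_norm)
        then have "?k n t * norm (g t - g s) \<le> ?k n t * (e / 2)"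
          by (intro mult_left_mono knn)
        moreover have "0 \<le> 2 * B * (cos_kernel L n \<delta> / mass n)"
          using B0 cos_kernel_nonneg mass_pos[of n] by simp
        moreover have "norm (?k n t *\<^sub>R (g t - g s)) = ?k n t * norm (g t - g s)"
          using knn[of t] by (simp only: norm_scaleR abs_of_nonneg)
        ultimately show ?thesis by (simp add: mult.commute)
      next
        case False
        have "cos_kernel L n (t - s) \<le> cos_kernel L n \<delta>"
          using False t s \<delta> L_pos by (intro cos_kernel_le) auto
        then have "?k n t \<le> cos_kernel L n \<delta> / mass n"
          using mass_pos[of n] by (intro divide_right_mono) auto
        moreover have "norm (g t - g s) \<le> 2 * B"
          using norm_triangle_ineq4[of "g t" "g s"] B[OF t] B[of s] s by auto
        ultimately have "?k n t * norm (g t - g s) \<le> cos_kernel L n \<delta> / mass n * (2 * B)"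
          by (intro mult_mono) (auto intro: divide_nonneg_pos cos_kernel_nonneg mass_pos)
        moreover have "norm (?k n t *\<^sub>R (g t - g s)) = ?k n t * norm (g t - g s)"
          using knn[of t] by (simp only: norm_scaleR abs_of_nonneg)
        moreover have "0 \<le> e / 2 * ?k n t" using \<open>0 < e\<close> knn[of t] by (intro mult_nonneg_nonneg) auto
        ultimately show ?thesis by (simp add: mult_ac)
      qed
      have "norm (integral {0..L} (\<lambda>t. ?k n t *\<^sub>R (g t - g s)))
          \<le> integral {0..L} (\<lambda>t. e / 2 * ?k n t + 2 * B * (cos_kernel L n \<delta> / mass n))"
        by (rule integral_norm_bound_integral[OF has_integral_integrable[OF D] has_integral_integrable[OF R] bd])
      then show ?thesis unfolding integral_unique[OF D] integral_unique[OF R] .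
    qed
    also have "L * (2 * B * (cos_kernel L n \<delta> / mass n)) = 2 * B * L * (cos_kernel L n \<delta> / mass n)"
      by simp
    also have "e / 2 * 1 + 2 * B * L * (cos_kernel L n \<delta> / mass n) < e" using N[OF n] by linarith
    finally show "norm (integral {0..L} (\<lambda>t. ?k n t *\<^sub>R g t) - g s) < e" .
  qed
qed

end

section \<open>Weak derivatives integrate to increments\<close>

context kernel_antideriv
begin

lemma continuous_P: "continuous_on A g \<Longrightarrow> continuous_on A (\<lambda>s. P n (g s))" for g :: "real \<Rightarrow> real"
  by (rule continuous_on_compose2[OF continuous_at_imp_continuous_on, of UNIV "P n"])
     (auto intro: DERIV_isCont[OF P])

text \<open>The quotient is the normalised kernel at \<open>s\<close> integrated against the
  indicator, which is continuous at \<open>s\<close> once \<open>a\<close> and \<open>b\<close> are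
  excluded.\<close>

lemma P_diff_tendsto_indicator:
  assumes "0 < a" "a < b" "b < L" "0 < s" "s < L" "s \<noteq> a" "s \<noteq> b"
  shows "(\<lambda>n. (P n (b - s) - P n (a - s)) / mass n) \<longlonglongrightarrow> indicat_real {a..b} s"
proof -
  have I: "((\<lambda>t. (cos_kernel L n (t - s) / mass n) *\<^sub>R indicat_real {a..b} t) has_integral
      (P n (b - s) - P n (a - s)) / mass n) {0..L}" for n
  proof -
    have "((\<lambda>t. cos_kernel L n (t - s) / mass n) has_integral
        (P n (b - s) - P n (a - s)) / mass n) {a..b}"
      by (intro has_integral_divide has_integral_cos_kernel) (use assms in simp)
    then have "((\<lambda>t. if t \<in> {a..b} then cos_kernel L n (t - s) / mass n else 0) has_integral
        (P n (b - s) - P n (a - s)) / mass n) {0..L}"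
      using assms by (subst has_integral_restrict) auto
    moreover have "(\<lambda>t. if t \<in> {a..b} then cos_kernel L n (t - s) / mass n else 0) =
        (\<lambda>t. (cos_kernel L n (t - s) / mass n) *\<^sub>R indicat_real {a..b} t)"
      by (auto simp: indicator_def)
    ultimately show ?thesis by simp
  qed
  have "isCont (indicat_real {a..b}) s"
    using assms by (intro isCont_indicator[THEN iffD2]) (simp add: frontier_def)
  from kernel_convergence[OF has_integral_integrable[OF I] _ assms(4,5) this, of 1]
  show ?thesis unfolding integral_unique[OF I] by (auto simp: indicator_def)
qed

text \<open>Both sides of the weak identity are followed to the limit with test function
  \<open>E n\<close>. The side with \<open>u\<close> becomes a difference of kernel averages
  converging to values of \<open>u\<close>; the side with \<open>v\<close> converges by dominated
  convergence, with dominating function \<open>norm (v s)\<close> because \<open>E n\<close> takes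
  values between 0 and 1.\<close>

lemma weak_deriv_has_integral:
  fixes u v :: "real \<Rightarrow> real ^ 'n"
  assumes u: "continuous_on UNIV u" and w: "weak_deriv L u v"
    and ab: "0 < a" "a < b" "b < L"
  shows "(v has_integral u b - u a) {a..b}"
proof -
  have vint: "integrable (circle L) v" using w by (simp add: weak_deriv_def)
  then have v: "v absolutely_integrable_on {0..L}" by (simp add: integrable_circle_iff)
  have uc: "continuous_on A u" for A using u continuous_on_subset by blast
  \<comment> \<open>The limit of \<open>E n\<close> is known only inside the period and away from
    the jumps \<open>a\<close> and \<open>b\<close>. Removing these four points makes the
    convergence hold everywhere on \<open>S\<close>.\<close>
  define Z where "Z = {0, a, b, L}"
  define S where "S = {0..L} - Z"
  have S: "(h has_integral y) S \<longleftrightarrow> (h has_integral y) {0..L}" for h :: "real \<Rightarrow> real ^ 'n" and y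
    unfolding S_def
    by (rule has_integral_spike_set_eq; rule negligible_subset[of Z]) (auto simp: Z_def)
  define E where "E n s = (P n (b - s) - P n (a - s)) / mass n" for n s
  have cE: "continuous_on A (E n)" for n A
    unfolding E_def by (intro continuous_intros continuous_P) (use mass_pos[of n] in auto)
  have E0: "0 \<le> E n s" for n s
    using P_mono[of "a - s" "b - s" n] ab mass_pos[of n] by (simp add: E_def)
  \<comment> \<open>As \<open>b - a < L\<close>, the increment of \<open>P n\<close> from
    \<open>a - s\<close> to \<open>b - s\<close> is at most its increment over a full
    period.\<close>
  have E1: "E n s \<le> 1" for n s
    using P_mono[of "b - s" "a - s + L" n] P_shift[of n "a - s"] ab mass_pos[of n]
    by (simp add: E_def)
  have iE: "(\<lambda>s. E n s *\<^sub>R v s) absolutely_integrable_on {0..L}" for n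
  proof (rule absolutely_integrable_bounded_measurable_product[OF bilinear_conv_bounded_bilinear[THEN iffD2, OF bounded_bilinear_scaleR] _ _ _ v])
    show "E n \<in> borel_measurable (lebesgue_on {0..L})"
      by (intro continuous_imp_measurable_on_sets_lebesgue cE) simp
    show "bounded (E n ` {0..L})"
      by (rule compact_imp_bounded[OF compact_continuous_image[OF cE]]) simp
  qed simp
  define k where "k n c s = cos_kernel L n (s - c) / mass n" for n c s
  have ku: "(\<lambda>s. k n c s *\<^sub>R u s) absolutely_integrable_on {0..L}" for n c
    unfolding k_def
    by (intro absolutely_integrable_continuous_real continuous_intros uc) (use mass_pos[of n] in auto)
  have "bounded (u ` {0..L})"
    by (rule compact_imp_bounded[OF compact_continuous_image[OF uc]]) simp
  then obtain B where B: "\<And>t. t \<in> {0..L} \<Longrightarrow> norm (u t) \<le> B"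
    unfolding bounded_iff by blast
  have uu: "isCont u c" for c using u by (simp add: continuous_on_eq_continuous_at)
  have lim: "(\<lambda>n. integral {0..L} (\<lambda>s. k n c s *\<^sub>R u s)) \<longlonglongrightarrow> u c" if "0 < c" "c < L" for c
    unfolding k_def
    by (rule kernel_convergence[OF _ B that uu])
       (use ku in \<open>auto simp: k_def dest: set_lebesgue_integral_eq_integral(1)\<close>)
  have eq: "integral {0..L} (\<lambda>s. E n s *\<^sub>R v s)
      = integral {0..L} (\<lambda>s. k n b s *\<^sub>R u s) - integral {0..L} (\<lambda>s. k n a s *\<^sub>R u s)" for n
  proof -
    have sym: "cos_kernel L n (a - s) = cos_kernel L n (s - a)"
      "cos_kernel L n (b - s) = cos_kernel L n (s - b)" for s
      using cos_kernel_minus[of L n "s - a"] cos_kernel_minus[of L n "s - b"] by simp_all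
    have m: "mass n \<noteq> 0" using mass_pos[of n] by simp
    have "(\<integral>s. deriv (\<lambda>s. P n (b - s) - P n (a - s)) s *\<^sub>R u s \<partial>circle L)
        = - (\<integral>s. (P n (b - s) - P n (a - s)) *\<^sub>R v s \<partial>circle L)"
      using w test_fun_P(1)[of n b a] unfolding weak_deriv_def by blast
    then have "(\<integral>s. (cos_kernel L n (a - s) - cos_kernel L n (b - s)) *\<^sub>R u s \<partial>circle L)
        = - (\<integral>s. (P n (b - s) - P n (a - s)) *\<^sub>R v s \<partial>circle L)"
      by (simp only: test_fun_P(2))
    also have "(\<lambda>s. (P n (b - s) - P n (a - s)) *\<^sub>R v s) = (\<lambda>s. mass n *\<^sub>R (E n s *\<^sub>R v s))"
      using m by (simp add: E_def)
    also have "(\<lambda>s. (cos_kernel L n (a - s) - cos_kernel L n (b - s)) *\<^sub>R u s)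
        = (\<lambda>s. mass n *\<^sub>R (k n a s *\<^sub>R u s - k n b s *\<^sub>R u s))"
      using m by (simp add: k_def sym scaleR_diff_left scaleR_diff_right)
    finally have "mass n *\<^sub>R (\<integral>s. (k n a s *\<^sub>R u s - k n b s *\<^sub>R u s) \<partial>circle L)
        = mass n *\<^sub>R (- (\<integral>s. E n s *\<^sub>R v s \<partial>circle L))"
      by (simp only: integral_scaleR_right scaleR_minus_right)
    then have "(\<integral>s. (k n a s *\<^sub>R u s - k n b s *\<^sub>R u s) \<partial>circle L)
        = - (\<integral>s. E n s *\<^sub>R v s \<partial>circle L)"
      by (rule scaleR_left_imp_eq[OF m])
    then have "(\<integral>s. k n a s *\<^sub>R u s \<partial>circle L) - (\<integral>s. k n b s *\<^sub>R u s \<partial>circle L)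
        = - (\<integral>s. E n s *\<^sub>R v s \<partial>circle L)"
      by (subst (asm) Bochner_Integration.integral_diff) (simp_all add: integrable_circle_iff ku)
    then have "integral {0..L} (\<lambda>s. k n a s *\<^sub>R u s) - integral {0..L} (\<lambda>s. k n b s *\<^sub>R u s)
        = - integral {0..L} (\<lambda>s. E n s *\<^sub>R v s)"
      using ku iE by (simp only: integrable_circle_iff integral_circle)
    from arg_cong[OF this, of uminus, symmetric] show ?thesis
      by (simp only: minus_diff_eq minus_minus)
  qed
  have "((\<lambda>s. indicat_real {a..b} s *\<^sub>R v s) has_integral u b - u a) S"
  proof (rule has_integral_dominated_convergence)
    show "((\<lambda>s. E n s *\<^sub>R v s) has_integral integral {0..L} (\<lambda>s. k n b s *\<^sub>R u s)
        - integral {0..L} (\<lambda>s. k n a s *\<^sub>R u s)) S" for n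
      by (subst eq[symmetric], subst S, rule integrable_integral) (rule set_lebesgue_integral_eq_integral(1)[OF iE])
    have "(\<lambda>s. norm (v s)) integrable_on {0..L}"
      using v by (simp add: absolutely_integrable_on_def)
    then show "(\<lambda>s. norm (v s)) integrable_on S"
    proof (rule integrable_spike_set)
      show "negligible {x \<in> {0..L} - S. norm (v x) \<noteq> 0}"
        by (rule negligible_subset[of Z]) (auto simp: S_def Z_def)
      show "negligible {x \<in> S - {0..L}. norm (v x) \<noteq> 0}"
        by (rule negligible_subset[of Z]) (auto simp: S_def Z_def)
    qed
    show "\<forall>s\<in>S. norm (E n s *\<^sub>R v s) \<le> norm (v s)" for n
      using E0[of n] E1[of n] by (auto intro: mult_left_le_one_le)
    show "\<forall>s\<in>S. (\<lambda>n. E n s *\<^sub>R v s) \<longlonglongrightarrow> indicat_real {a..b} s *\<^sub>R v s"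
    proof
      fix s assume "s \<in> S"
      then have "(\<lambda>n. E n s) \<longlonglongrightarrow> indicat_real {a..b} s"
        unfolding E_def by (intro P_diff_tendsto_indicator ab) (auto simp: S_def Z_def less_le)
      then show "(\<lambda>n. E n s *\<^sub>R v s) \<longlonglongrightarrow> indicat_real {a..b} s *\<^sub>R v s"
        by (rule tendsto_scaleR[OF _ tendsto_const])
    qed
    show "(\<lambda>n. integral {0..L} (\<lambda>s. k n b s *\<^sub>R u s) - integral {0..L} (\<lambda>s. k n a s *\<^sub>R u s))
        \<longlonglongrightarrow> u b - u a"
      using ab by (auto intro!: tendsto_diff lim)
  qed
  then have "((\<lambda>s. indicat_real {a..b} s *\<^sub>R v s) has_integral u b - u a) {0..L}"
    by (simp add: S)
  moreover have "(\<lambda>s. indicat_real {a..b} s *\<^sub>R v s) = (\<lambda>s. if s \<in> {a..b} then v s else 0)"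
    by (auto simp: indicator_def)
  ultimately show ?thesis
    using ab has_integral_restrict[of "{a..b}" "{0..L}" v] by auto
qed

end

lemma weak_deriv_has_integral_interior:
  fixes u v :: "real \<Rightarrow> real ^ 'n"
  assumes "0 < L" "continuous_on UNIV u" "weak_deriv L u v" "0 < a" "a < b" "b < L"
  shows "(v has_integral u b - u a) {a..b}"
proof -
  have *: "\<exists>P. \<forall>x. (P has_real_derivative cos_kernel L n x) (at x)" for n
    using cos_kernel_antiderivative by blast
  obtain P where "\<forall>n x. (P n has_real_derivative cos_kernel L n x) (at x)"
    using choice[of "\<lambda>n P. \<forall>x. (P has_real_derivative cos_kernel L n x) (at x)"] * by blast
  then interpret kernel_antideriv L P using assms by unfold_locales auto
  show ?thesis using weak_deriv_has_integral assms(2-) .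
qed

section \<open>Loops with bounded weak derivative\<close>

text \<open>One-sided Lebesgue differentiation is applied to \<open>g\<close> and to its reflection.
  The bounds are multiplied by \<open>h\<close> so that they match the epsilon-delta form of the
  derivative.\<close>

lemma has_vector_derivative_integral_two_sided:
  fixes g :: "real \<Rightarrow> 'a::euclidean_space"
  assumes "\<And>a b. g integrable_on {a..b}"
  obtains N where "negligible N"
    "\<And>x e. x \<notin> N \<Longrightarrow> 0 < e \<Longrightarrow> \<exists>d>0. \<forall>h. 0 < h \<and> h < d \<longrightarrow>
       norm (integral {x..x + h} g - h *\<^sub>R g x) < e * h \<and>
       norm (integral {x - h..x} g - h *\<^sub>R g x) < e * h"
proof -
  have bound: "norm (i - h *\<^sub>R y) < e * h" if "norm (i /\<^sub>R h - y) < e" "0 < h"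
    for i y :: 'a and h e :: real
  proof -
    have "i - h *\<^sub>R y = h *\<^sub>R (i /\<^sub>R h - y)" using that by (simp add: scaleR_diff_right)
    then have "norm (i - h *\<^sub>R y) = h * norm (i /\<^sub>R h - y)" using that by (simp only: norm_scaleR)
    also have "\<dots> < h * e" using that by simp
    finally show ?thesis by (simp add: mult.commute)
  qed
  have right: "\<exists>N. negligible N \<and> (\<forall>x e. x \<notin> N \<longrightarrow> 0 < e \<longrightarrow> (\<exists>d>0. \<forall>h. 0 < h \<and> h < d \<longrightarrow>
      norm (integral {x..x + h} f /\<^sub>R h - f x) < e))"
    if f: "\<And>a b. f integrable_on {a..b}" for f :: "real \<Rightarrow> 'a"
  proof -
    obtain N where "negligible N" "\<And>x e. x \<notin> N \<Longrightarrow> 0 < e \<Longrightarrow> \<exists>d>0. \<forall>h. 0 < h \<and> h < d \<longrightarrow>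
        norm (integral {x..x + h} f /\<^sub>R h - f x) < e"
      using integrable_ccontinuous_explicit[of f] f by auto
    then show ?thesis by blast
  qed
  obtain N1 where N1: "negligible N1" "\<And>x e. x \<notin> N1 \<Longrightarrow> 0 < e \<Longrightarrow> \<exists>d>0. \<forall>h. 0 < h \<and> h < d \<longrightarrow>
      norm (integral {x..x + h} g /\<^sub>R h - g x) < e"
    using right[OF assms] by blast
  have "(\<lambda>x. g (- x)) integrable_on {a..b}" for a b
    using assms[of "- b" "- a"] Henstock_Kurzweil_Integration.integrable_reflect_real[where f = g and a = "- b" and b = "- a"]
    by (simp only: minus_minus)
  then obtain N2 where N12: "negligible N2 \<and> (\<forall>x e. x \<notin> N2 \<longrightarrow> 0 < e \<longrightarrow> (\<exists>d>0. \<forall>h. 0 < h \<and> h < d \<longrightarrow>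
      norm (integral {x..x + h} (\<lambda>x. g (- x)) /\<^sub>R h - g (- x)) < e))"
    by (rule right[THEN exE])
  then have N2: "negligible N2" by simp
  have N2': "\<exists>d>0. \<forall>h. 0 < h \<and> h < d \<longrightarrow>
      norm (integral {x..x + h} (\<lambda>x. g (- x)) /\<^sub>R h - g (- x)) < e" if "x \<notin> N2" "0 < e" for x e
    using N12 that by blast
  have "negligible (uminus ` N2)"
    by (rule negligible_differentiable_image_negligible[OF order_refl N2])
       (simp add: differentiable_on_def differentiable_minus differentiable_ident)
  show thesis
  proof (rule that[of "N1 \<union> uminus ` N2"])
    show "negligible (N1 \<union> uminus ` N2)" using N1(1) \<open>negligible (uminus ` N2)\<close> by simp
    fix x e :: real assume x: "x \<notin> N1 \<union> uminus ` N2" and e: "0 < e"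
    then have "- x \<notin> N2" using image_eqI[of x uminus "- x" N2] by auto
    obtain d1 where d1: "0 < d1" "\<And>h. 0 < h \<Longrightarrow> h < d1 \<Longrightarrow> norm (integral {x..x + h} g /\<^sub>R h - g x) < e"
      using N1(2)[of x e] x e by auto
    obtain d2 where d2: "0 < d2"
      "\<And>h. 0 < h \<Longrightarrow> h < d2 \<Longrightarrow> norm (integral {- x..- x + h} (\<lambda>x. g (- x)) /\<^sub>R h - g x) < e"
      using N2'[OF \<open>- x \<notin> N2\<close> e] by auto
    have refl: "integral {- x..- x + h} (\<lambda>x. g (- x)) = integral {x - h..x} g" for h
      using Henstock_Kurzweil_Integration.integral_reflect_real[of x "x - h" g] by simp
    show "\<exists>d>0. \<forall>h. 0 < h \<and> h < d \<longrightarrow>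
       norm (integral {x..x + h} g - h *\<^sub>R g x) < e * h \<and>
       norm (integral {x - h..x} g - h *\<^sub>R g x) < e * h"
    proof (intro exI conjI allI impI)
      show "0 < min d1 d2" using d1(1) d2(1) by simp
      fix h assume h: "0 < h \<and> h < min d1 d2"
      show "norm (integral {x..x + h} g - h *\<^sub>R g x) < e * h"
        using d1(2)[of h] h by (intro bound) auto
      show "norm (integral {x - h..x} g - h *\<^sub>R g x) < e * h"
        using d2(2)[of h, unfolded refl] h by (intro bound) auto
    qed
  qed
qed

lemma indefinite_integral_has_vector_derivative_AE:
  fixes u v :: "real \<Rightarrow> 'a::euclidean_space"
  assumes v: "v integrable_on {a..b}"
    and u: "\<And>c d. a < c \<Longrightarrow> c \<le> d \<Longrightarrow> d < b \<Longrightarrow> integral {c..d} v = u d - u c"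
  obtains N where "negligible N" "\<And>x. x \<in> {a<..<b} - N \<Longrightarrow> (u has_vector_derivative v x) (at x)"
proof -
  \<comment> \<open>Extension by zero makes the integrand integrable on every interval and leaves
    its integrals inside \<open>{a..b}\<close> unchanged.\<close>
  define g where "g x = (if x \<in> {a..b} then v x else 0)" for x
  have "g integrable_on {c..d}" for c d
  proof -
    have "g integrable_on UNIV"
      unfolding g_def using v by (rule integrable_restrict_UNIV[THEN iffD2])
    then show ?thesis by (rule integrable_on_subinterval) simp
  qed
  then obtain N where N: "negligible N"
    "\<And>x e. x \<notin> N \<Longrightarrow> 0 < e \<Longrightarrow> \<exists>d>0. \<forall>h. 0 < h \<and> h < d \<longrightarrow>
       norm (integral {x..x + h} g - h *\<^sub>R g x) < e * h \<and>
       norm (integral {x - h..x} g - h *\<^sub>R g x) < e * h"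
    using has_vector_derivative_integral_two_sided by blast
  have gu: "integral {c..d} g = u d - u c" if "a < c" "c \<le> d" "d < b" for c d
  proof -
    have "integral {c..d} g = integral {c..d} v"
      by (rule Henstock_Kurzweil_Integration.integral_cong) (use that in \<open>auto simp: g_def\<close>)
    with u[OF that] show ?thesis by simp
  qed
  show thesis
  proof (rule that[OF N(1)])
    fix x assume x: "x \<in> {a<..<b} - N"
    then have gx: "g x = v x" by (simp add: g_def)
    show "(u has_vector_derivative v x) (at x)"
      unfolding has_vector_derivative_def has_derivative_at_alt
    proof (intro conjI allI impI)
      show "bounded_linear (\<lambda>y. y *\<^sub>R v x)" by (rule bounded_linear_scaleR_left)
      fix e :: real assume "0 < e"
      obtain d where d: "0 < d" "\<And>h. 0 < h \<Longrightarrow> h < d \<Longrightarrow>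
         norm (integral {x..x + h} g - h *\<^sub>R g x) < e * h \<and>
         norm (integral {x - h..x} g - h *\<^sub>R g x) < e * h"
        using N(2)[of x e] x \<open>0 < e\<close> by auto
      show "\<exists>d>0. \<forall>y. norm (y - x) < d \<longrightarrow> norm (u y - u x - (y - x) *\<^sub>R v x) \<le> e * norm (y - x)"
      proof (intro exI conjI allI impI)
        show "0 < min d (min (x - a) (b - x))" using d x by simp
        fix y assume y: "norm (y - x) < min d (min (x - a) (b - x))"
        consider "y = x" | "x < y" | "y < x" by linarith
        then show "norm (u y - u x - (y - x) *\<^sub>R v x) \<le> e * norm (y - x)"
        proof cases
          case 2
          then have "norm (integral {x..y} g - (y - x) *\<^sub>R g x) < e * (y - x)"
            using d(2)[of "y - x"] y by simp
          then show ?thesis using gu[of x y] 2 x y by (simp add: gx)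
        next
          case 3
          then have "norm (integral {y..x} g - (x - y) *\<^sub>R g x) < e * (x - y)"
            using d(2)[of "x - y"] y by simp
          then have "norm ((u x - u y) - (x - y) *\<^sub>R v x) < e * (x - y)"
            using gu[of y x] 3 x y by (simp add: gx)
          moreover have "(u x - u y) - (x - y) *\<^sub>R v x = - (u y - u x - (y - x) *\<^sub>R v x)"
            by (simp add: algebra_simps)
          ultimately show ?thesis using 3 by (simp only: norm_minus_cancel) simp
        qed simp
      qed
    qed
  qed
qed

section \<open>Periodicity and negligible sets\<close>

lemma periodic_int:
  assumes "periodic L u" shows "u (s + of_int k * L) = u s"
proof -
  have nat: "u (s + of_nat n * L) = u s" for s n
  proof (induction n)
    case (Suc n)
    have "u (s + of_nat (Suc n) * L) = u (s + of_nat n * L + L)" by (simp add: algebra_simps)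
    then show ?case using assms Suc by (simp add: periodic_def)
  qed simp
  show ?thesis
  proof (cases k)
    case (nonneg n)
    then show ?thesis using nat by simp
  next
    case (neg n)
    have "s + of_int k * L + of_nat (Suc n) * L = s" unfolding neg by (simp add: algebra_simps)
    with nat[of "s + of_int k * L" "Suc n"] show ?thesis by (simp only:)
  qed
qed

lemma periodic_has_vector_derivative_iff:
  assumes "periodic L u"
  shows "(u has_vector_derivative d) (at (s + of_int k * L)) \<longleftrightarrow> (u has_vector_derivative d) (at s)"
proof -
  have *: "(u has_vector_derivative d) (at s)" if "(u has_vector_derivative d) (at (s + of_int k * L))" for s k
  proof -
    have "((\<lambda>s. s + of_int k * L) has_vector_derivative 1) (at s)"
      by (auto intro!: derivative_eq_intros)
    from vector_diff_chain_at[OF this that] show ?thesis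
      by (simp add: o_def periodic_int[OF assms])
  qed
  show ?thesis using *[of s k] *[of "s + of_int k * L" "- k"] by auto
qed

lemma periodic_velocity: "periodic L u \<Longrightarrow> velocity u (s + of_int k * L) = velocity u s"
  unfolding velocity_def vector_derivative_def by (simp only: periodic_has_vector_derivative_iff)

text \<open>Stated with the classical derivative, so that it passes to linear combinations and applies to
  the perturbed curves.\<close>

definition lipschitz_loop :: "real \<Rightarrow> (real \<Rightarrow> real ^ 'n) \<Rightarrow> bool" where
  "lipschitz_loop L u \<longleftrightarrow> periodic L u \<and>
     (\<exists>C. AE s in lebesgue. u differentiable (at s) \<and> norm (velocity u s) \<le> C) \<and>
     (\<forall>a b. a \<le> b \<longrightarrow> velocity u absolutely_integrable_on {a..b} \<and>
        integral {a..b} (velocity u) = u b - u a)"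

lemma AE_lebesgue_negligible_iff: "(AE s in lebesgue. P s) \<longleftrightarrow> negligible {s. \<not> P s}"
proof -
  have "{s \<in> space lebesgue. \<not> P s} = {s. \<not> P s}" by simp
  then show ?thesis unfolding completion.AE_iff_null_sets negligible_iff_null_sets by (rule ssubst) (rule refl)
qed

lemma AE_circle_negligible: "(AE s in circle L. P s) \<Longrightarrow> negligible {s \<in> {0..<L}. \<not> P s}"
  for P :: "real \<Rightarrow> bool"
proof -
  assume "AE s in circle L. P s"
  then have "AE s in lebesgue. s \<in> {0..<L} \<longrightarrow> P s"
    by (simp add: AE_restrict_space_iff)
  then show ?thesis unfolding AE_lebesgue_negligible_iff by simp
qed

lemma velocity_eq: "(u has_vector_derivative d) (at s) \<Longrightarrow> velocity u s = d"
  unfolding velocity_def by (rule vector_derivative_at)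

lemma has_vector_derivative_velocity:
  "u differentiable (at s) \<Longrightarrow> (u has_vector_derivative velocity u s) (at s)"
  unfolding velocity_def by (rule vector_derivative_works[THEN iffD1])

text \<open>The exceptional set is covered by countably many translates of its part in one
  period.\<close>

lemma AE_lebesgue_periodic:
  fixes P :: "real \<Rightarrow> bool"
  assumes "0 < L" "negligible {s \<in> {0..<L}. \<not> P s}"
    and P: "\<And>s k. P (s + of_int k * L) \<longleftrightarrow> P s"
  shows "AE s in lebesgue. P s"
proof -
  let ?N = "{s \<in> {0..<L}. \<not> P s}"
  have "{s. \<not> P s} \<subseteq> (\<Union>k::int. (+) (of_int k * L) ` ?N)"
  proof
    fix s assume "s \<in> {s. \<not> P s}"
    define k where "k = \<lfloor>s / L\<rfloor>"
    have "of_int k \<le> s / L" "s / L < of_int k + 1" unfolding k_def by linarith+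
    then have "0 \<le> s - of_int k * L" "s - of_int k * L < L"
      using assms(1) by (simp_all add: field_simps)
    moreover have "\<not> P (s - of_int k * L)"
      using P[of "s - of_int k * L" k] \<open>s \<in> _\<close> by simp
    ultimately have "s - of_int k * L \<in> ?N" by simp
    then show "s \<in> (\<Union>k::int. (+) (of_int k * L) ` ?N)"
      by (intro UN_I[of k] image_eqI[of _ _ "s - of_int k * L"]) auto
  qed
  moreover have "negligible (\<Union>k::int. (+) (of_int k * L) ` ?N)"
  proof (rule negligible_countable_Union)
    fix S assume "S \<in> range (\<lambda>k::int. (+) (of_int k * L) ` ?N)"
    then show "negligible S" using negligible_translation[OF assms(2)] by blast
  qed simp
  ultimately show ?thesis
    unfolding AE_lebesgue_negligible_iff by (rule negligible_subset[rotated])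
qed

text \<open>Inside the period \<open>u\<close> is an indefinite integral of \<open>v\<close>, so it
  is classically differentiable almost everywhere with derivative \<open>v\<close>, and
  \<open>velocity u\<close> inherits integrability and the bound. The increment formula is wanted up
  to both end points, because only then can neighbouring periods be glued.\<close>

lemma sobolev_inf_velocity:
  fixes u :: "real \<Rightarrow> real ^ 'n"
  assumes L: "0 < L" and u: "u \<in> sobolev_inf L"
  shows "velocity u absolutely_integrable_on {0..L}"
    and "\<And>c d. 0 \<le> c \<Longrightarrow> c \<le> d \<Longrightarrow> d \<le> L \<Longrightarrow> (velocity u has_integral u d - u c) {c..d}"
    and "\<exists>C. AE s in lebesgue. u differentiable (at s) \<and> norm (velocity u s) \<le> C"
proof -
  obtain v C where cont: "continuous_on UNIV u" and per: "periodic L u"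
    and w: "weak_deriv L u v" and C: "AE s in circle L. norm (v s) \<le> C"
    using u unfolding sobolev_inf_def by blast
  have v: "v absolutely_integrable_on {0..L}"
    using w by (simp add: weak_deriv_def integrable_circle_iff)
  have vi: "v integrable_on {0..L}" using v by (rule set_lebesgue_integral_eq_integral(1))
  have int0: "integral {c..d} v = u d - u c" if "0 < c" "c \<le> d" "d < L" for c d
  proof (cases "c = d")
    case False
    then show ?thesis
      using weak_deriv_has_integral_interior[OF L cont w, of c d] that by (auto intro: integral_unique)
  qed simp
  obtain N where N: "negligible N"
    "\<And>x. x \<in> {0<..<L} - N \<Longrightarrow> (u has_vector_derivative v x) (at x)"
    using indefinite_integral_has_vector_derivative_AE[OF vi int0] by metis
  have vel: "velocity u x = v x" if "x \<in> {0..L} - (N \<union> {0, L})" for x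
    using N(2)[of x] that by (intro velocity_eq) auto
  have neg: "negligible (N \<union> {0, L})" using N(1) by simp
  show vel_abs: "velocity u absolutely_integrable_on {0..L}"
    by (rule absolutely_integrable_spike[OF v neg vel])
  \<comment> \<open>The interior formula makes this difference constant on the open period; being
    continuous on the closed one, it keeps the same value at the end points \<open>0\<close> and
    \<open>L\<close>.\<close>
  define w' where "w' x = u x - integral {0..x} v" for x
  have w'c: "continuous_on {0..L} w'"
    unfolding w'_def using cont
    by (intro continuous_on_diff indefinite_integral_continuous_1 vi) (rule continuous_on_subset, auto)
  have w'eq: "w' d = w' (L / 2)" if "d \<in> {0<..<L}" for d
  proof -
    have step: "w' d = w' c" if "0 < c" "c \<le> d" "d < L" for c d
    proof -
      have "integral {0..c} v + integral {c..d} v = integral {0..d} v"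
        using that by (intro Henstock_Kurzweil_Integration.integral_combine)
          (auto intro: integrable_on_subinterval[OF vi])
      then show ?thesis unfolding w'_def using int0[OF that] by (simp add: algebra_simps)
    qed
    show ?thesis using step[of "L / 2" d] step[of d "L / 2"] that L by (cases "L / 2 \<le> d") auto
  qed
  have w'const: "w' d = w' (L / 2)" if "d \<in> {0..L}" for d
  proof (rule continuous_constant_on_closure[of "{0<..<L}" w'])
    show "continuous_on (closure {0<..<L}) w'" "d \<in> closure {0<..<L}"
      using L that w'c by simp_all
  qed (rule w'eq)
  show "(velocity u has_integral u d - u c) {c..d}" if "0 \<le> c" "c \<le> d" "d \<le> L" for c d
  proof -
    have "integral {0..c} v + integral {c..d} v = integral {0..d} v"
      using that by (intro Henstock_Kurzweil_Integration.integral_combine)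
        (auto intro: integrable_on_subinterval[OF vi])
    from this[symmetric] have "integral {c..d} v = integral {0..d} v - integral {0..c} v" by simp
    moreover have "w' d = w' c" using w'const[of c] w'const[of d] that by simp
    then have "integral {0..d} v - integral {0..c} v = u d - u c"
      unfolding w'_def by (simp add: algebra_simps)
    ultimately have eq: "integral {c..d} v = u d - u c" by simp
    have "v integrable_on {c..d}"
      using that by (intro integrable_on_subinterval[OF vi]) auto
    then have "(v has_integral u d - u c) {c..d}" unfolding eq[symmetric] by (rule integrable_integral)
    then show ?thesis
      by (rule has_integral_spike[OF neg, rotated]) (use vel that in auto)
  qed
  have "AE s in lebesgue. u differentiable (at s) \<and> norm (velocity u s) \<le> C"
  proof (rule AE_lebesgue_periodic[OF L])
    show "(u differentiable at (s + of_int k * L) \<and> norm (velocity u (s + of_int k * L)) \<le> C)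
        = (u differentiable at s \<and> norm (velocity u s) \<le> C)" for s k
    proof -
      have "u differentiable at x \<longleftrightarrow> (\<exists>d. (u has_vector_derivative d) (at x))" for x
        by (auto intro: differentiableI_vector has_vector_derivative_velocity)
      then show ?thesis
        by (simp only: periodic_has_vector_derivative_iff[OF per] periodic_velocity[OF per])
    qed
    show "negligible {s \<in> {0..<L}. \<not> (u differentiable at s \<and> norm (velocity u s) \<le> C)}"
    proof (rule negligible_subset)
      show "negligible ((N \<union> {0, L}) \<union> {s \<in> {0..<L}. \<not> norm (v s) \<le> C})"
        using neg AE_circle_negligible[OF C] by simp
      show "{s \<in> {0..<L}. \<not> (u differentiable at s \<and> norm (velocity u s) \<le> C)}
          \<subseteq> (N \<union> {0, L}) \<union> {s \<in> {0..<L}. \<not> norm (v s) \<le> C}"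
      proof
        fix s assume s: "s \<in> {s \<in> {0..<L}. \<not> (u differentiable at s \<and> norm (velocity u s) \<le> C)}"
        show "s \<in> (N \<union> {0, L}) \<union> {s \<in> {0..<L}. \<not> norm (v s) \<le> C}"
        proof (rule ccontr)
          assume "\<not> ?thesis"
          with s have "s \<in> {0<..<L} - N" "s \<in> {0..L} - (N \<union> {0, L})" "norm (v s) \<le> C" by auto
          with s vel[of s] differentiableI_vector[OF N(2), of s] show False by auto
        qed
      qed
    qed
  qed
  then show "\<exists>C. AE s in lebesgue. u differentiable (at s) \<and> norm (velocity u s) \<le> C" by blast
qed

text \<open>Arcs of the loop may pass through a multiple of \<open>L\<close>. The formula on one
  period is translated to every period, and the pieces are added.\<close>

lemma sobolev_inf_lipschitz_loop:
  fixes u :: "real \<Rightarrow> real ^ 'n"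
  assumes L: "0 < L" and u: "u \<in> sobolev_inf L"
  shows "lipschitz_loop L u"
proof -
  have per: "periodic L u" using u by (simp add: sobolev_inf_def)
  let ?Q = "\<lambda>a b. velocity u absolutely_integrable_on {a..b} \<and> integral {a..b} (velocity u) = u b - u a"
  have combine: "?Q a b" if "?Q a c" "?Q c b" "a \<le> c" "c \<le> b" for a b c
  proof
    show ai: "velocity u absolutely_integrable_on {a..b}"
      by (rule absolutely_integrable_on_combine[where c = c]) (use that in auto)
    have "integral {a..c} (velocity u) + integral {c..b} (velocity u) = integral {a..b} (velocity u)"
      using that set_lebesgue_integral_eq_integral(1)[OF ai]
      by (intro Henstock_Kurzweil_Integration.integral_combine) auto
    then show "integral {a..b} (velocity u) = u b - u a" using that by (simp add: algebra_simps)
  qed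
  have cell: "?Q a b" if "of_int k * L \<le> a" "a \<le> b" "b \<le> (of_int k + 1) * L" for a b and k :: int
  proof -
    define c d where "c = a - of_int k * L" and "d = b - of_int k * L"
    have cd: "0 \<le> c" "c \<le> d" "d \<le> L" using that by (simp_all add: c_def d_def algebra_simps)
    have vs: "velocity u (x + - (of_int k * L)) = velocity u x" for x
      using periodic_velocity[OF per, of x "- k"] by simp
    have abs: "velocity u absolutely_integrable_on {c..d}"
      by (rule absolutely_integrable_on_subinterval[OF sobolev_inf_velocity(1)[OF L u]]) (use cd in auto)
    have "velocity u integrable_on {a..b}"
      using integrable_shift_real_ivl[where f = "velocity u" and a = c and b = d and c = "- (of_int k * L)"]
        set_lebesgue_integral_eq_integral(1)[OF abs] by (simp only: vs) (simp add: c_def d_def)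
    moreover have "(\<lambda>x. norm (velocity u x)) integrable_on {a..b}"
      using integrable_shift_real_ivl[where f = "\<lambda>x. norm (velocity u x)" and a = c and b = d and c = "- (of_int k * L)"] abs
      unfolding absolutely_integrable_on_def by (simp only: vs) (simp add: c_def d_def)
    moreover have "integral {a..b} (velocity u) = u b - u a"
    proof -
      have "(velocity u has_integral u d - u c) {a..b}"
        using has_integral_shift_real_ivl[OF sobolev_inf_velocity(2)[OF L u cd], of "- (of_int k * L)"]
        by (simp only: vs) (simp add: c_def d_def)
      moreover have "u c = u a" "u d = u b"
        using periodic_int[OF per, of a "- k"] periodic_int[OF per, of b "- k"] by (simp_all add: c_def d_def)
      ultimately show ?thesis by (simp add: integral_unique)
    qed
    ultimately show ?thesis by (simp add: absolutely_integrable_on_def)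
  qed
  \<comment> \<open>Induction on the number \<open>m\<close> of consecutive periods that the
    interval may meet; the last period is split off at \<open>c\<close>.\<close>
  have cells: "\<forall>a b. of_int k * L \<le> a \<longrightarrow> a \<le> b \<longrightarrow> b \<le> (of_int k + of_nat m) * L \<longrightarrow> ?Q a b"
    for k :: int and m :: nat
  proof (induction m)
    case 0
    show ?case
    proof (intro allI impI)
      fix a b :: real assume "of_int k * L \<le> a" "a \<le> b" "b \<le> (of_int k + of_nat 0) * L"
      then show "?Q a b" using L by (intro cell[of k]) (auto simp: algebra_simps)
    qed
  next
    case (Suc m)
    show ?case
    proof (intro allI impI)
      fix a b :: real assume ab: "of_int k * L \<le> a" "a \<le> b" "b \<le> (of_int k + of_nat (Suc m)) * L"
      define c where "c = (of_int k + of_nat m) * L"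
      have bc: "?Q x b" if "c \<le> x" "x \<le> b" for x
        using that ab(3) by (intro cell[of "k + int m"]) (auto simp: c_def algebra_simps)
      consider "b \<le> c" | "c \<le> a" | "a \<le> c" "c \<le> b" by linarith
      then show "?Q a b"
      proof cases
        case 1
        then show ?thesis using Suc.IH ab(1,2) unfolding c_def by blast
      next
        case 2
        then show ?thesis using bc ab(2) by blast
      next
        case 3
        have "?Q a c" using Suc.IH ab(1) 3(1) unfolding c_def by blast
        then show ?thesis using bc[of c] 3 combine[of a c b] by blast
      qed
    qed
  qed
  have "?Q a b" if "a \<le> b" for a b
  proof -
    define k where "k = \<lfloor>a / L\<rfloor>"
    have "of_int k \<le> a / L" unfolding k_def by linarith
    then have ka: "of_int k * L \<le> a" using L by (simp add: field_simps)
    obtain m where "b / L - of_int k < of_nat m" using reals_Archimedean2 by blast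
    then have "b \<le> (of_int k + of_nat m) * L" using L by (simp add: field_simps)
    with cells ka that show ?thesis by blast
  qed
  with per sobolev_inf_velocity(3)[OF L u] show ?thesis by (simp add: lipschitz_loop_def)
qed

lemma lipschitz_loop_AE:
  assumes "lipschitz_loop L u"
  obtains C where "0 \<le> C" "AE s in lebesgue. (u has_vector_derivative velocity u s) (at s) \<and> norm (velocity u s) \<le> C"
proof -
  obtain C where "AE s in lebesgue. u differentiable (at s) \<and> norm (velocity u s) \<le> C"
    using assms by (auto simp: lipschitz_loop_def)
  then have "AE s in lebesgue. (u has_vector_derivative velocity u s) (at s) \<and> norm (velocity u s) \<le> max 0 C"
    by eventually_elim (auto intro: has_vector_derivative_velocity)
  then show thesis using that[of "max 0 C"] by simp
qed

lemma lipschitz_loop_AE_derivative: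
  assumes "lipschitz_loop L u"
  shows "AE s in lebesgue. (u has_vector_derivative velocity u s) (at s)"
proof (rule lipschitz_loop_AE[OF assms])
  fix C assume "AE s in lebesgue. (u has_vector_derivative velocity u s) (at s) \<and> norm (velocity u s) \<le> C"
  then show ?thesis by eventually_elim simp
qed

lemma velocity_add_scaleR:
  assumes "(u has_vector_derivative velocity u s) (at s)" "(w has_vector_derivative velocity w s) (at s)"
  shows "((\<lambda>s. u s + x *\<^sub>R w s) has_vector_derivative velocity u s + x *\<^sub>R velocity w s) (at s)"
    and "velocity (\<lambda>s. u s + x *\<^sub>R w s) s = velocity u s + x *\<^sub>R velocity w s"
proof -
  show "((\<lambda>s. u s + x *\<^sub>R w s) has_vector_derivative velocity u s + x *\<^sub>R velocity w s) (at s)"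
    using assms by (auto intro!: derivative_eq_intros)
  then show "velocity (\<lambda>s. u s + x *\<^sub>R w s) s = velocity u s + x *\<^sub>R velocity w s"
    by (rule velocity_eq)
qed

text \<open>\<open>velocity\<close> is known to be linear only where both derivatives exist, so
  integrability and integrals are transferred across a negligible set.\<close>

lemma lipschitz_loop_add_scaleR:
  assumes u: "lipschitz_loop L u" and w: "lipschitz_loop L w"
  shows "lipschitz_loop L (\<lambda>s. u s + x *\<^sub>R w s)"
proof -
  let ?g = "\<lambda>s. u s + x *\<^sub>R w s"
  obtain C where C: "AE s in lebesgue. (u has_vector_derivative velocity u s) (at s) \<and> norm (velocity u s) \<le> C"
    using lipschitz_loop_AE[OF u] .
  obtain D where D: "AE s in lebesgue. (w has_vector_derivative velocity w s) (at s) \<and> norm (velocity w s) \<le> D"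
    using lipschitz_loop_AE[OF w] .
  have vel: "AE s in lebesgue. (?g has_vector_derivative velocity u s + x *\<^sub>R velocity w s) (at s)
      \<and> velocity ?g s = velocity u s + x *\<^sub>R velocity w s"
    using C D by eventually_elim (auto intro: velocity_add_scaleR)
  define N where "N = {s. \<not> (velocity ?g s = velocity u s + x *\<^sub>R velocity w s)}"
  have N: "negligible N"
    unfolding N_def AE_lebesgue_negligible_iff[symmetric] using vel by eventually_elim simp
  have AE: "AE s in lebesgue. ?g differentiable (at s) \<and> norm (velocity ?g s) \<le> C + \<bar>x\<bar> * D"
    using C D vel
  proof eventually_elim
    case (elim s)
    have "norm (velocity u s + x *\<^sub>R velocity w s) \<le> norm (velocity u s) + \<bar>x\<bar> * norm (velocity w s)"
      using norm_triangle_ineq[of "velocity u s" "x *\<^sub>R velocity w s"] by simp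
    also have "\<dots> \<le> C + \<bar>x\<bar> * D" using elim by (intro add_mono mult_left_mono) auto
    finally show ?case using elim by (auto intro: differentiableI_vector)
  qed
  have "velocity ?g absolutely_integrable_on {a..b} \<and> integral {a..b} (velocity ?g) = ?g b - ?g a"
    if "a \<le> b" for a b
  proof -
    have ai: "velocity u absolutely_integrable_on {a..b}" "velocity w absolutely_integrable_on {a..b}"
      and i: "integral {a..b} (velocity u) = u b - u a" "integral {a..b} (velocity w) = w b - w a"
      using u w that by (auto simp: lipschitz_loop_def)
    have ai': "(\<lambda>s. velocity u s + x *\<^sub>R velocity w s) absolutely_integrable_on {a..b}"
      using ai by (intro set_integral_add absolutely_integrable_scaleR_left)
    have "integral {a..b} (velocity ?g) = integral {a..b} (\<lambda>s. velocity u s + x *\<^sub>R velocity w s)"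
      by (rule integral_spike[OF N]) (simp add: N_def)
    also have "\<dots> = integral {a..b} (velocity u) + x *\<^sub>R integral {a..b} (velocity w)"
      using ai[THEN set_lebesgue_integral_eq_integral(1)]
      by (subst Henstock_Kurzweil_Integration.integral_add) (auto intro: integrable_cmul)
    finally have "integral {a..b} (velocity ?g) = ?g b - ?g a"
      by (simp add: i algebra_simps)
    moreover have "velocity ?g absolutely_integrable_on {a..b}"
      by (rule absolutely_integrable_spike[OF ai' N]) (simp add: N_def)
    ultimately show ?thesis by blast
  qed
  moreover have "periodic L ?g" using u w by (simp add: lipschitz_loop_def periodic_def)
  ultimately show ?thesis using AE by (auto simp: lipschitz_loop_def)
qed

section \<open>Second-order variations of real functions\<close>

lemma eventually_abs_less: "0 < r \<Longrightarrow> \<forall>\<^sub>F x in nhds (0::real). \<bar>x\<bar> < r"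
  unfolding eventually_nhds_metric by (intro exI[of _ r]) (auto simp: dist_real_def)

text \<open>The partial derivatives at the origin, in the order in which \<open>has_var2\<close> and \<open>var2\<close> take
  them.\<close>

definition second_order :: "(real \<Rightarrow> real \<Rightarrow> real) \<Rightarrow> real \<Rightarrow> (real \<Rightarrow> real) \<Rightarrow> real \<Rightarrow> bool" where
  "second_order q q\<^sub>1 q\<^sub>2 q\<^sub>1\<^sub>2 \<longleftrightarrow>
     (\<forall>\<^sub>F x in nhds 0. (q x has_real_derivative q\<^sub>2 x) (at 0)) \<and>
     ((\<lambda>x. q x 0) has_real_derivative q\<^sub>1) (at 0) \<and>
     (q\<^sub>2 has_real_derivative q\<^sub>1\<^sub>2) (at 0)"

lemma second_orderD:
  assumes "second_order q q\<^sub>1 q\<^sub>2 q\<^sub>1\<^sub>2"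
  shows "\<forall>\<^sub>F x in nhds 0. (q x has_real_derivative q\<^sub>2 x) (at 0)"
    and "((\<lambda>x. q x 0) has_real_derivative q\<^sub>1) (at 0)"
    and "(q\<^sub>2 has_real_derivative q\<^sub>1\<^sub>2) (at 0)"
    and "(q 0 has_real_derivative q\<^sub>2 0) (at 0)"
  using assms eventually_nhds_x_imp_x[of "\<lambda>x. (q x has_real_derivative q\<^sub>2 x) (at 0)" 0]
  by (auto simp: second_order_def)

text \<open>The expressions of \<open>M_a\<close> and \<open>M_density\<close> through chord and arc
  hold only for small parameters. Agreement on a square around the origin suffices, since all
  derivatives are taken at points arbitrarily close to it.\<close>

lemma second_order_cong:
  assumes q: "second_order q q\<^sub>1 q\<^sub>2 q\<^sub>1\<^sub>2" and "0 < r"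
    and eq: "\<forall>x y. \<bar>x\<bar> < r \<longrightarrow> \<bar>y\<bar> < r \<longrightarrow> q x y = q' x y"
  shows "second_order q' q\<^sub>1 q\<^sub>2 q\<^sub>1\<^sub>2"
proof -
  note near = eventually_abs_less[OF \<open>0 < r\<close>]
  have "\<forall>\<^sub>F x in nhds 0. (q' x has_real_derivative q\<^sub>2 x) (at 0)"
    using second_orderD(1)[OF q] near
  proof eventually_elim
    case (elim x)
    have "\<forall>\<^sub>F y in nhds 0. q x y = q' x y"
      using near by eventually_elim (use elim eq in auto)
    from DERIV_cong_ev[OF refl this refl] elim show ?case by blast
  qed
  moreover have "((\<lambda>x. q' x 0) has_real_derivative q\<^sub>1) (at 0)"
  proof -
    have "\<forall>\<^sub>F x in nhds 0. q x 0 = q' x 0"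
      using near by eventually_elim (use \<open>0 < r\<close> eq in auto)
    from DERIV_cong_ev[OF refl this refl] second_orderD(2)[OF q] show ?thesis by blast
  qed
  ultimately show ?thesis using second_orderD(3)[OF q] by (simp add: second_order_def)
qed

lemma second_order_diff:
  assumes q: "second_order q q\<^sub>1 q\<^sub>2 q\<^sub>1\<^sub>2" and h: "second_order h h\<^sub>1 h\<^sub>2 h\<^sub>1\<^sub>2"
  shows "second_order (\<lambda>x y. q x y - h x y) (q\<^sub>1 - h\<^sub>1) (\<lambda>x. q\<^sub>2 x - h\<^sub>2 x) (q\<^sub>1\<^sub>2 - h\<^sub>1\<^sub>2)"
proof -
  have "\<forall>\<^sub>F x in nhds 0. ((\<lambda>y. q x y - h x y) has_real_derivative q\<^sub>2 x - h\<^sub>2 x) (at 0)"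
    using second_orderD(1)[OF q] second_orderD(1)[OF h] by eventually_elim (rule DERIV_diff)
  then show ?thesis
    using second_orderD(2,3)[OF q] second_orderD(2,3)[OF h]
    by (auto simp: second_order_def intro: DERIV_diff)
qed

lemma second_order_mult:
  assumes q: "second_order q q\<^sub>1 q\<^sub>2 q\<^sub>1\<^sub>2" and h: "second_order h h\<^sub>1 h\<^sub>2 h\<^sub>1\<^sub>2"
  shows "second_order (\<lambda>x y. q x y * h x y) (q\<^sub>1 * h 0 0 + h\<^sub>1 * q 0 0)
    (\<lambda>x. q\<^sub>2 x * h x 0 + h\<^sub>2 x * q x 0)
    (q\<^sub>1\<^sub>2 * h 0 0 + h\<^sub>1 * q\<^sub>2 0 + (h\<^sub>1\<^sub>2 * q 0 0 + q\<^sub>1 * h\<^sub>2 0))"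
proof -
  note q' = second_orderD[OF q] and h' = second_orderD[OF h]
  have "\<forall>\<^sub>F x in nhds 0. ((\<lambda>y. q x y * h x y) has_real_derivative q\<^sub>2 x * h x 0 + h\<^sub>2 x * q x 0) (at 0)"
    using q'(1) h'(1) by eventually_elim (rule DERIV_mult)
  then show ?thesis
    unfolding second_order_def
    using DERIV_mult[OF q'(2) h'(2)] DERIV_add[OF DERIV_mult[OF q'(3) h'(2)] DERIV_mult[OF h'(3) q'(2)]]
    by simp
qed

lemma eventually_pos_nhds:
  assumes "(g has_real_derivative d) (at x)" "0 < g x"
  shows "\<forall>\<^sub>F y in nhds x. 0 < (g y :: real)"
  using DERIV_isCont[OF assms(1)] assms(2)
  by (auto simp: isCont_def tendsto_at_iff_tendsto_nhds dest: order_tendstoD(1))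

text \<open>Applied to chord and arc with a negative exponent. The mixed derivative is left
  unspecified because only its existence enters later.\<close>

lemma second_order_powr:
  assumes q: "second_order q q\<^sub>1 q\<^sub>2 q\<^sub>1\<^sub>2" and pos: "0 < q 0 0"
  shows "\<exists>d. second_order (\<lambda>x y. q x y powr c) (c * q 0 0 powr (c - 1) * q\<^sub>1)
    (\<lambda>x. c * q x 0 powr (c - 1) * q\<^sub>2 x) d"
proof -
  note q' = second_orderD[OF q]
  have "\<forall>\<^sub>F x in nhds 0. ((\<lambda>y. q x y powr c) has_real_derivative c * q x 0 powr (c - 1) * q\<^sub>2 x) (at 0)"
    using q'(1) eventually_pos_nhds[OF q'(2) pos]
    by eventually_elim (use DERIV_fun_powr in fastforce)
  moreover have "((\<lambda>x. q x 0 powr c) has_real_derivative c * q 0 0 powr (c - 1) * q\<^sub>1) (at 0)"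
    using DERIV_fun_powr[OF q'(2) pos, of c] by simp
  moreover have "((\<lambda>x. q x 0 powr (c - 1)) has_real_derivative (c - 1) * q 0 0 powr (c - 1 - 1) * q\<^sub>1) (at 0)"
    using DERIV_fun_powr[OF q'(2) pos, of "c - 1"] by simp
  from DERIV_mult[OF DERIV_cmult[OF this, of c] q'(3)]
  have "\<exists>d. ((\<lambda>x. c * q x 0 powr (c - 1) * q\<^sub>2 x) has_real_derivative d) (at 0)" by blast
  ultimately show ?thesis unfolding second_order_def by blast
qed

section \<open>Powers of nonnegative functions\<close>

lemma DERIV_nonneg_zero:
  fixes g :: "real \<Rightarrow> real"
  assumes "(g has_real_derivative d) (at x)" "\<forall>\<^sub>F y in nhds x. 0 \<le> g y" "g x = 0"
  shows "d = 0"
proof -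
  obtain e where "0 < e" "\<And>y. dist y x < e \<Longrightarrow> 0 \<le> g y"
    using assms(2) by (auto simp: eventually_nhds_metric)
  then show ?thesis
    using DERIV_local_min[OF assms(1), of e] assms(3) by (auto simp: dist_real_def abs_minus_commute)
qed

text \<open>At a zero of \<open>g\<close> the derivative \<open>d\<close> vanishes by minimality. As
  soon as \<open>g y < 1\<close>, \<open>g y powr p \<le> g y\<close>, so the difference quotient of
  the power is dominated by that of \<open>g\<close> and tends to 0, whatever the value of the
  \<open>rpow\<close> factor.\<close>

lemma has_real_derivative_rpow:
  fixes g :: "real \<Rightarrow> real"
  assumes g: "(g has_real_derivative d) (at x)" and nonneg: "\<forall>\<^sub>F y in nhds x. 0 \<le> g y" and p: "1 \<le> p"
  shows "((\<lambda>y. g y powr p) has_real_derivative p * rpow (g x) (p - 1) * d) (at x)"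
proof (cases "g x = 0")
  case False
  then have "0 < g x" using eventually_nhds_x_imp_x[OF nonneg] by simp
  then show ?thesis using DERIV_fun_powr[OF g, of p] by (auto simp: rpow_def)
next
  case True
  then have d: "d = 0" using DERIV_nonneg_zero[OF g nonneg] by simp
  have "((\<lambda>y. g y powr p) has_real_derivative 0) (at x)"
    unfolding has_field_derivative_iff
  proof (rule Lim_null_comparison)
    have "((\<lambda>y. (g y - g x) / (y - x)) \<longlongrightarrow> 0) (at x)"
      using g unfolding has_field_derivative_iff d .
    then show "((\<lambda>y. \<bar>(g y - g x) / (y - x)\<bar>) \<longlongrightarrow> 0) (at x)"
      by (rule tendsto_rabs_zero)
    have "(g \<longlongrightarrow> 0) (at x)" using DERIV_isCont[OF g] True by (simp add: isCont_def)
    then have "\<forall>\<^sub>F y in at x. g y < 1" by (rule order_tendstoD(2)) simp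
    moreover have "\<forall>\<^sub>F y in at x. 0 \<le> g y" using nonneg by (simp add: eventually_nhds_conv_at)
    ultimately show "\<forall>\<^sub>F y in at x. norm ((g y powr p - g x powr p) / (y - x)) \<le> \<bar>(g y - g x) / (y - x)\<bar>"
    proof eventually_elim
      case (elim y)
      have "g y powr p \<le> g y powr 1"
        using powr_mono'[of 1 p "g y"] elim p by simp
      then have "\<bar>g y powr p\<bar> \<le> \<bar>g y\<bar>" using elim by simp
      then show ?case using True p by (simp add: abs_divide divide_right_mono)
    qed
  qed
  then show ?thesis by (simp add: d)
qed

text \<open>At a positive value this is the chain rule. At a zero with \<open>p > 1\<close> the
  power \<open>p - 1\<close> need not be differentiable, but \<open>m\<^sub>2 0 = 0\<close>: the
  difference quotient of the product is then \<open>m x 0 powr (p - 1)\<close>, which tends to 0,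
  times the difference quotient of \<open>m\<^sub>2\<close>.\<close>

lemma second_order_rpow:
  assumes m: "second_order m m\<^sub>1 m\<^sub>2 m\<^sub>1\<^sub>2" and p: "1 \<le> p" and "0 < r"
    and nonneg: "\<And>x y. \<bar>x\<bar> < r \<Longrightarrow> \<bar>y\<bar> < r \<Longrightarrow> 0 \<le> m x y"
  shows "second_order (\<lambda>x y. m x y powr p) (p * rpow (m 0 0) (p - 1) * m\<^sub>1)
    (\<lambda>x. p * (rpow (m x 0) (p - 1) * m\<^sub>2 x))
    (p * (rpow (m 0 0) (p - 1) * m\<^sub>1\<^sub>2 + (p - 1) * rpow (m 0 0) (p - 2) * m\<^sub>1 * m\<^sub>2 0))"
proof -
  note m' = second_orderD[OF m]
  note near = eventually_abs_less[OF \<open>0 < r\<close>]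
  have ny: "\<forall>\<^sub>F y in nhds 0. 0 \<le> m x y" if "\<bar>x\<bar> < r" for x
    using near by eventually_elim (use nonneg that in auto)
  have nx: "\<forall>\<^sub>F x in nhds 0. 0 \<le> m x 0"
    using near by eventually_elim (use nonneg \<open>0 < r\<close> in auto)
  have 1: "\<forall>\<^sub>F x in nhds 0. ((\<lambda>y. m x y powr p) has_real_derivative p * (rpow (m x 0) (p - 1) * m\<^sub>2 x)) (at 0)"
    using m'(1) near
  proof eventually_elim
    case (elim x)
    show ?case using has_real_derivative_rpow[OF elim(1) ny[OF elim(2)] p] by (simp add: mult.assoc)
  qed
  have 2: "((\<lambda>x. m x 0 powr p) has_real_derivative p * rpow (m 0 0) (p - 1) * m\<^sub>1) (at 0)"
    by (rule has_real_derivative_rpow[OF m'(2) nx p])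
  have 3: "((\<lambda>x. rpow (m x 0) (p - 1) * m\<^sub>2 x) has_real_derivative
      rpow (m 0 0) (p - 1) * m\<^sub>1\<^sub>2 + (p - 1) * rpow (m 0 0) (p - 2) * m\<^sub>1 * m\<^sub>2 0) (at 0)"
  proof (cases "m 0 0 = 0")
    case False
    then have pos: "0 < m 0 0" using nonneg[of 0 0] \<open>0 < r\<close> by simp
    have rp: "rpow t c = t powr c" if "0 < t" for t c using that by (simp add: rpow_def)
    have "((\<lambda>x. m x 0 powr (p - 1)) has_real_derivative (p - 1) * m 0 0 powr (p - 2) * m\<^sub>1) (at 0)"
      using DERIV_fun_powr[OF m'(2) pos, of "p - 1"] by simp
    from DERIV_mult[OF this m'(3)]
    have D: "((\<lambda>x. m x 0 powr (p - 1) * m\<^sub>2 x) has_real_derivative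
        rpow (m 0 0) (p - 1) * m\<^sub>1\<^sub>2 + (p - 1) * rpow (m 0 0) (p - 2) * m\<^sub>1 * m\<^sub>2 0) (at 0)"
      using pos by (simp add: rp algebra_simps)
    have "\<forall>\<^sub>F x in nhds 0. m x 0 powr (p - 1) * m\<^sub>2 x = rpow (m x 0) (p - 1) * m\<^sub>2 x"
      using eventually_pos_nhds[OF m'(2) pos] by eventually_elim (simp add: rp)
    from DERIV_cong_ev[OF refl this refl] D show ?thesis by blast
  next
    case True
    have m2: "m\<^sub>2 0 = 0" using DERIV_nonneg_zero[OF m'(4) ny[of 0] True] \<open>0 < r\<close> by simp
    show ?thesis
    \<comment> \<open>For \<open>p = 1\<close> the factor is constantly 1 by the convention in
      \<open>rpow\<close>, and the mixed derivative is \<open>m\<^sub>1\<^sub>2\<close>; for larger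
      \<open>p\<close> it is 0.\<close>
    proof (cases "p = 1")
      case True
      then show ?thesis using m'(3) m2 by (simp add: rpow_def)
    next
      case False
      with p have p1: "0 < p - 1" by simp
      have "((\<lambda>x. m x 0) \<longlongrightarrow> 0) (at 0)" using DERIV_isCont[OF m'(2)] True by (simp add: isCont_def)
      moreover have "\<forall>\<^sub>F x in at 0. 0 \<le> m x 0" using nx by (simp add: eventually_nhds_conv_at)
      ultimately have "((\<lambda>x. m x 0 powr (p - 1)) \<longlongrightarrow> 0) (at 0)"
        by (intro tendsto_zero_powrI[OF _ tendsto_const _ p1])
      moreover have "((\<lambda>x. (m\<^sub>2 x - m\<^sub>2 0) / (x - 0)) \<longlongrightarrow> m\<^sub>1\<^sub>2) (at 0)"
        using m'(3) unfolding has_field_derivative_iff .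
      ultimately have "((\<lambda>x. m x 0 powr (p - 1) * ((m\<^sub>2 x - m\<^sub>2 0) / (x - 0))) \<longlongrightarrow> 0 * m\<^sub>1\<^sub>2) (at 0)"
        by (rule tendsto_mult)
      then have "((\<lambda>x. rpow (m x 0) (p - 1) * m\<^sub>2 x) has_real_derivative 0) (at 0)"
        unfolding has_field_derivative_iff using False m2 by (simp add: rpow_def)
      then show ?thesis using False m2 True by (simp add: rpow_def)
    qed
  qed
  show ?thesis using 1 2 DERIV_cmult[OF 3, of p] by (simp add: second_order_def)
qed

section \<open>Norms along affine families and their integrals\<close>

lemma has_real_derivative_norm_line:
  fixes P R :: "'a::real_inner"
  assumes "P \<noteq> 0"
  shows "((\<lambda>y. norm (P + y *\<^sub>R R)) has_real_derivative (P \<bullet> R) / norm P) (at 0)"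
proof -
  have "((\<lambda>y. P + y *\<^sub>R R) has_derivative (\<lambda>y. y *\<^sub>R R)) (at 0)"
    by (auto intro!: derivative_eq_intros)
  moreover have "(norm has_derivative (\<lambda>h. h \<bullet> sgn P)) (at (P + 0 *\<^sub>R R))"
    using has_derivative_norm[of P] assms by simp
  ultimately have "((\<lambda>y. norm (P + y *\<^sub>R R)) has_derivative (\<lambda>y. (y *\<^sub>R R) \<bullet> sgn P)) (at 0)"
    by (rule has_derivative_compose)
  moreover have "(\<lambda>y. (y *\<^sub>R R) \<bullet> sgn P) = (*) ((P \<bullet> R) / norm P)"
    by (auto simp: sgn_div_norm inner_commute field_simps)
  ultimately show ?thesis by (simp add: has_field_derivative_def)
qed

text \<open>The derivative is the Hessian of the norm at \<open>P\<close>, evaluated on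
  \<open>Q\<close> and \<open>R\<close>.\<close>

lemma has_real_derivative_norm_line_inner:
  fixes P Q R :: "'a::real_inner"
  assumes "P \<noteq> 0"
  shows "((\<lambda>x. ((P + x *\<^sub>R Q) \<bullet> R) / norm (P + x *\<^sub>R Q)) has_real_derivative
    (Q \<bullet> R) / norm P - (P \<bullet> Q) * (P \<bullet> R) / norm P ^ 3) (at 0)"
proof -
  have "((\<lambda>x. (P + x *\<^sub>R Q) \<bullet> R) has_real_derivative Q \<bullet> R) (at 0)"
  proof -
    have "((\<lambda>x. P \<bullet> R + x * (Q \<bullet> R)) has_real_derivative Q \<bullet> R) (at 0)"
      by (auto intro!: derivative_eq_intros)
    then show ?thesis by (simp add: inner_add_left)
  qed
  from DERIV_divide[OF this has_real_derivative_norm_line[OF assms, of Q]] assms show ?thesis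
    by (simp add: field_simps power3_eq_cube)
qed

lemma second_order_norm:
  fixes P Q R :: "'a::real_inner"
  assumes "P \<noteq> 0"
  shows "second_order (\<lambda>x y. norm (P + x *\<^sub>R Q + y *\<^sub>R R)) ((P \<bullet> Q) / norm P)
    (\<lambda>x. ((P + x *\<^sub>R Q) \<bullet> R) / norm (P + x *\<^sub>R Q))
    ((Q \<bullet> R) / norm P - (P \<bullet> Q) * (P \<bullet> R) / norm P ^ 3)"
proof -
  have "0 < norm (P + 0 *\<^sub>R Q)" using assms by simp
  from eventually_pos_nhds[OF has_real_derivative_norm_line[OF assms, of Q] this]
  have "\<forall>\<^sub>F x in nhds 0. P + x *\<^sub>R Q \<noteq> 0" by simp
  then have "\<forall>\<^sub>F x in nhds 0. ((\<lambda>y. norm (P + x *\<^sub>R Q + y *\<^sub>R R)) has_real_derivative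
      ((P + x *\<^sub>R Q) \<bullet> R) / norm (P + x *\<^sub>R Q)) (at 0)"
    by eventually_elim (rule has_real_derivative_norm_line)
  then show ?thesis
    using has_real_derivative_norm_line[OF assms, of Q] has_real_derivative_norm_line_inner[OF assms, of Q R]
    by (simp add: second_order_def)
qed

lemma has_var_if_second_order:
  assumes q: "second_order (\<lambda>x y. F (\<lambda>s. f s + x *\<^sub>R \<phi> s + y *\<^sub>R \<psi> s)) q\<^sub>1 q\<^sub>2 q\<^sub>1\<^sub>2"
  shows "has_var1 F f \<phi>" "var1 F f \<phi> = q\<^sub>1" "has_var1 F f \<psi>" "var1 F f \<psi> = q\<^sub>2 0"
    "has_var2 F f \<phi> \<psi>" "var2 F f \<phi> \<psi> = q\<^sub>1\<^sub>2"
proof -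
  note q' = second_orderD[OF q]
  have 1: "((\<lambda>\<epsilon>. F (\<lambda>s. f s + \<epsilon> *\<^sub>R \<phi> s)) has_real_derivative q\<^sub>1) (at 0)" using q'(2) by simp
  have 2: "((\<lambda>\<epsilon>. F (\<lambda>s. f s + \<epsilon> *\<^sub>R \<psi> s)) has_real_derivative q\<^sub>2 0) (at 0)" using q'(4) by simp
  show "has_var1 F f \<phi>" "var1 F f \<phi> = q\<^sub>1" "has_var1 F f \<psi>" "var1 F f \<psi> = q\<^sub>2 0"
    unfolding has_var1_def var1_def field_differentiable_def
    using 1 2 by (auto intro: DERIV_imp_deriv)
  let ?d = "\<lambda>\<epsilon>\<^sub>1. deriv (\<lambda>\<epsilon>\<^sub>2. F (\<lambda>s. f s + \<epsilon>\<^sub>1 *\<^sub>R \<phi> s + \<epsilon>\<^sub>2 *\<^sub>R \<psi> s)) 0"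
  have "\<forall>\<^sub>F x in nhds 0. q\<^sub>2 x = ?d x"
    using q'(1) by eventually_elim (auto intro: DERIV_imp_deriv[symmetric])
  from DERIV_cong_ev[OF refl this refl] q'(3) have d: "(?d has_real_derivative q\<^sub>1\<^sub>2) (at 0)" by blast
  have "\<forall>\<^sub>F x in nhds 0. (\<lambda>y. F (\<lambda>s. f s + x *\<^sub>R \<phi> s + y *\<^sub>R \<psi> s)) field_differentiable (at 0)"
    using q'(1) by eventually_elim (auto simp: field_differentiable_def)
  with d show "has_var2 F f \<phi> \<psi>" unfolding has_var2_def field_differentiable_def by blast
  show "var2 F f \<phi> \<psi> = q\<^sub>1\<^sub>2" unfolding var2_def using d by (rule DERIV_imp_deriv)
qed

text \<open>Dominated convergence is applied along sequences. For this reason the null set in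
  \<open>lip\<close> may depend on the parameter, and a Lipschitz bound relative to the base point
  alone dominates the difference quotients.\<close>

lemma has_real_derivative_integral:
  fixes h :: "real \<Rightarrow> 'a \<Rightarrow> real"
  assumes M: "finite_measure M" and int: "\<And>x. integrable M (h x)" and h': "h' \<in> borel_measurable M"
    and D: "AE s in M. ((\<lambda>x. h x s) has_real_derivative h' s) (at x\<^sub>0)"
    and r: "0 < r"
    and lip: "\<And>x. \<bar>x - x\<^sub>0\<bar> < r \<Longrightarrow> AE s in M. \<bar>h x s - h x\<^sub>0 s\<bar> \<le> K * \<bar>x - x\<^sub>0\<bar>"
  shows "((\<lambda>x. integral\<^sup>L M (h x)) has_real_derivative integral\<^sup>L M h') (at x\<^sub>0)"
  unfolding has_field_derivative_iff tendsto_at_iff_sequentially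
proof (intro allI impI)
  interpret finite_measure M by (rule M)
  fix X :: "nat \<Rightarrow> real" assume X: "\<forall>i. X i \<in> UNIV - {x\<^sub>0}" and lim: "X \<longlonglongrightarrow> x\<^sub>0"
  obtain N where N: "\<And>n. N \<le> n \<Longrightarrow> \<bar>X n - x\<^sub>0\<bar> < r"
    using LIMSEQ_D[OF lim r] by auto
  define Y where "Y n = X (n + N)" for n
  have Y: "Y n \<noteq> x\<^sub>0" "\<bar>Y n - x\<^sub>0\<bar> < r" for n using X N[of "n + N"] by (auto simp: Y_def)
  have "Y \<longlonglongrightarrow> x\<^sub>0" unfolding Y_def using lim by (rule LIMSEQ_ignore_initial_segment)
  then have Yat: "filterlim Y (at x\<^sub>0) sequentially" using Y(1) by (simp add: filterlim_at)
  have "(\<lambda>n. integral\<^sup>L M (\<lambda>s. (h (Y n) s - h x\<^sub>0 s) / (Y n - x\<^sub>0))) \<longlonglongrightarrow> integral\<^sup>L M h'"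
  proof (rule integral_dominated_convergence)
    show "integrable M (\<lambda>s. \<bar>K\<bar>)" by simp
    show "(\<lambda>s. (h (Y n) s - h x\<^sub>0 s) / (Y n - x\<^sub>0)) \<in> borel_measurable M" for n
      using int by (intro borel_measurable_divide borel_measurable_diff borel_measurable_const) auto
    show "AE s in M. (\<lambda>n. (h (Y n) s - h x\<^sub>0 s) / (Y n - x\<^sub>0)) \<longlonglongrightarrow> h' s"
      using D
    proof eventually_elim
      case (elim s)
      then show ?case unfolding has_field_derivative_iff by (rule filterlim_compose[OF _ Yat])
    qed
    show "AE s in M. norm ((h (Y n) s - h x\<^sub>0 s) / (Y n - x\<^sub>0)) \<le> \<bar>K\<bar>" for n
      using lip[OF Y(2)[of n]]
    proof eventually_elim
      case (elim s)
      have "K * \<bar>Y n - x\<^sub>0\<bar> \<le> \<bar>K\<bar> * \<bar>Y n - x\<^sub>0\<bar>" by (intro mult_right_mono) auto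
      with elim have "\<bar>h (Y n) s - h x\<^sub>0 s\<bar> \<le> \<bar>K\<bar> * \<bar>Y n - x\<^sub>0\<bar>" by linarith
      then show ?case using Y(1)[of n] by (simp add: abs_divide pos_divide_le_eq)
    qed
  qed (rule h')
  moreover have "integral\<^sup>L M (\<lambda>s. (h (Y n) s - h x\<^sub>0 s) / (Y n - x\<^sub>0)) =
      (integral\<^sup>L M (h (Y n)) - integral\<^sup>L M (h x\<^sub>0)) / (Y n - x\<^sub>0)" for n
    using int by simp
  ultimately have "(\<lambda>n. (integral\<^sup>L M (h (X (n + N))) - integral\<^sup>L M (h x\<^sub>0)) / (X (n + N) - x\<^sub>0))
      \<longlonglongrightarrow> integral\<^sup>L M h'"
    by (simp only: Y_def)
  then show "((\<lambda>y. (integral\<^sup>L M (h y) - integral\<^sup>L M (h x\<^sub>0)) / (y - x\<^sub>0)) \<circ> X) \<longlonglongrightarrow> integral\<^sup>L M h'"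
    unfolding o_def by (rule LIMSEQ_offset)
qed

text \<open>The radius makes the perturbing term at most 1/2; adding 1 to \<open>C\<close> keeps the
  radius meaningful for \<open>C = 0\<close>.\<close>

lemma norm_add_scaleR_ge_half:
  fixes v w :: "'a::real_normed_vector"
  assumes "norm v = 1" "norm w \<le> C" "0 \<le> C" "\<bar>x\<bar> < 1 / (2 * (C + 1))"
  shows "1 / 2 \<le> norm (v + x *\<^sub>R w)"
proof -
  have "\<bar>x\<bar> * norm w \<le> 1 / (2 * (C + 1)) * C" using assms by (intro mult_mono) auto
  also have "\<dots> \<le> 1 / 2" using assms(3) by (simp add: field_simps)
  finally have "norm (x *\<^sub>R w) \<le> 1 / 2" by simp
  then show ?thesis using norm_triangle_ineq2[of v "- (x *\<^sub>R w)"] assms(1) by simp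
qed

text \<open>With \<open>p\<close> the perturbed vector, \<open>p / norm p - v\<close> is
  \<open>p - norm p * v\<close> divided by \<open>norm p\<close>. The numerator is at most twice
  \<open>norm (p - v)\<close> and the denominator at least 1/2, whence the factor 4. This is the
  dominating bound for differentiating a first derivative of length once more.\<close>

lemma sgn_inner_lipschitz:
  fixes v w z :: "'a::real_inner"
  assumes v: "norm v = 1" and w: "norm w \<le> C" and z: "norm z \<le> C" and C: "0 \<le> C"
    and x: "\<bar>x\<bar> < 1 / (2 * (C + 1))"
  shows "\<bar>((v + x *\<^sub>R w) \<bullet> z) / norm (v + x *\<^sub>R w) - v \<bullet> z\<bar> \<le> 4 * C * C * \<bar>x\<bar>"
proof -
  define p where "p = v + x *\<^sub>R w"
  have p: "1 / 2 \<le> norm p" unfolding p_def by (rule norm_add_scaleR_ge_half) fact+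
  have pv: "norm (p - v) \<le> C * \<bar>x\<bar>"
    using mult_right_mono[OF w abs_ge_zero[of x]] by (simp add: p_def mult.commute)
  have "p - norm p *\<^sub>R v = (p - v) + (1 - norm p) *\<^sub>R v" by (simp add: scaleR_diff_left)
  moreover have "norm ((p - v) + (1 - norm p) *\<^sub>R v) \<le> norm (p - v) + \<bar>1 - norm p\<bar>"
    using norm_triangle_ineq[of "p - v" "(1 - norm p) *\<^sub>R v"] v by simp
  ultimately have "norm (p - norm p *\<^sub>R v) \<le> norm (p - v) + \<bar>1 - norm p\<bar>" by (simp only:)
  also have "\<bar>1 - norm p\<bar> \<le> norm (p - v)"
    using norm_triangle_ineq3[of p v] v by (simp add: abs_minus_commute)
  finally have num: "norm (p - norm p *\<^sub>R v) \<le> 2 * (C * \<bar>x\<bar>)" using pv by simp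
  have "(p \<bullet> z) / norm p - v \<bullet> z = ((p - norm p *\<^sub>R v) \<bullet> z) / norm p"
    using p by (auto simp: inner_diff_left diff_divide_distrib)
  then have "\<bar>(p \<bullet> z) / norm p - v \<bullet> z\<bar> = \<bar>(p - norm p *\<^sub>R v) \<bullet> z\<bar> / norm p" by simp
  also have "\<dots> \<le> (2 * (C * \<bar>x\<bar>) * C) / (1 / 2)"
  proof (rule frac_le)
    have "\<bar>(p - norm p *\<^sub>R v) \<bullet> z\<bar> \<le> norm (p - norm p *\<^sub>R v) * norm z"
      by (rule Cauchy_Schwarz_ineq2)
    also have "\<dots> \<le> 2 * (C * \<bar>x\<bar>) * C"
      using num z C by (intro mult_mono) auto
    finally show "\<bar>(p - norm p *\<^sub>R v) \<bullet> z\<bar> \<le> 2 * (C * \<bar>x\<bar>) * C" .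
  qed (use p C in auto)
  finally show ?thesis by (simp add: p_def mult_ac)
qed

text \<open>The first derivatives are dominated by the reverse triangle inequality, the mixed one by
  \<open>sgn_inner_lipschitz\<close>. The radius \<open>?r\<close> keeps
  \<open>v s + x *\<^sub>R w s\<close> away from zero, which is needed because the derivative in
  \<open>y\<close> must exist for all small \<open>x\<close>, not only for
  \<open>x = 0\<close>.\<close>

lemma second_order_integral_norm:
  fixes v w z :: "'a \<Rightarrow> 'b::euclidean_space"
  assumes M: "finite_measure M"
    and meas: "v \<in> borel_measurable M" "w \<in> borel_measurable M" "z \<in> borel_measurable M"
    and v: "AE s in M. norm (v s) = 1" and w: "AE s in M. norm (w s) \<le> C" and z: "AE s in M. norm (z s) \<le> C"
    and C: "0 \<le> C"
  shows "\<exists>d\<^sub>1 d\<^sub>2 d\<^sub>1\<^sub>2. second_order (\<lambda>x y. integral\<^sup>L M (\<lambda>s. norm (v s + x *\<^sub>R w s + y *\<^sub>R z s))) d\<^sub>1 d\<^sub>2 d\<^sub>1\<^sub>2"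
proof -
  interpret finite_measure M by (rule M)
  note [measurable] = meas
  let ?r = "1 / (2 * (C + 1))"
  have r: "0 < ?r" using C by simp
  have int: "integrable M (\<lambda>s. norm (v s + x *\<^sub>R w s + y *\<^sub>R z s))" for x y
  proof (rule integrable_const_bound)
    show "AE s in M. norm (norm (v s + x *\<^sub>R w s + y *\<^sub>R z s)) \<le> 1 + \<bar>x\<bar> * C + \<bar>y\<bar> * C"
      using v w z
    proof eventually_elim
      case (elim s)
      have "norm (v s + x *\<^sub>R w s + y *\<^sub>R z s) \<le> norm (v s) + norm (x *\<^sub>R w s) + norm (y *\<^sub>R z s)"
        by (rule norm_triangle_mono[OF norm_triangle_ineq order_refl])
      also have "\<dots> \<le> 1 + \<bar>x\<bar> * C + \<bar>y\<bar> * C"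
        using elim by (auto intro!: add_mono mult_left_mono)
      finally show ?case by simp
    qed
  qed measurable
  have Dn: "((\<lambda>y. integral\<^sup>L M (\<lambda>s. norm (v s + x *\<^sub>R w s + y *\<^sub>R z s))) has_real_derivative
      integral\<^sup>L M (\<lambda>s. ((v s + x *\<^sub>R w s) \<bullet> z s) / norm (v s + x *\<^sub>R w s))) (at 0)" if x: "\<bar>x\<bar> < ?r" for x
  \<comment> \<open>The Lipschitz bound in \<open>y\<close> holds without restriction on
    \<open>y\<close>, so the radius 1 is an arbitrary choice.\<close>
  proof (rule has_real_derivative_integral[OF M int _ _ zero_less_one, where K = C])
    show "AE s in M. ((\<lambda>y. norm (v s + x *\<^sub>R w s + y *\<^sub>R z s)) has_real_derivative
        ((v s + x *\<^sub>R w s) \<bullet> z s) / norm (v s + x *\<^sub>R w s)) (at 0)"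
      using v w
    proof eventually_elim
      case (elim s)
      from norm_add_scaleR_ge_half[OF elim C x] show ?case by (intro has_real_derivative_norm_line) auto
    qed
    show "AE s in M. \<bar>norm (v s + x *\<^sub>R w s + y *\<^sub>R z s) - norm (v s + x *\<^sub>R w s + 0 *\<^sub>R z s)\<bar> \<le> C * \<bar>y - 0\<bar>" for y
      using z
    proof eventually_elim
      case (elim s)
      have "\<bar>norm (v s + x *\<^sub>R w s + y *\<^sub>R z s) - norm (v s + x *\<^sub>R w s)\<bar> \<le> norm (y *\<^sub>R z s)"
        using norm_triangle_ineq3[of "v s + x *\<^sub>R w s + y *\<^sub>R z s" "v s + x *\<^sub>R w s"] by simp
      also have "\<dots> \<le> C * \<bar>y\<bar>" using mult_right_mono[OF elim abs_ge_zero[of y]] by (simp add: mult.commute)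
      finally show ?case by simp
    qed
  qed measurable
  have D1: "((\<lambda>x. integral\<^sup>L M (\<lambda>s. norm (v s + x *\<^sub>R w s + 0 *\<^sub>R z s))) has_real_derivative
      integral\<^sup>L M (\<lambda>s. (v s \<bullet> w s) / norm (v s))) (at 0)"
  proof (rule has_real_derivative_integral[OF M int _ _ zero_less_one, where K = C])
    show "AE s in M. ((\<lambda>x. norm (v s + x *\<^sub>R w s + 0 *\<^sub>R z s)) has_real_derivative
        (v s \<bullet> w s) / norm (v s)) (at 0)"
      using v
    proof eventually_elim
      case (elim s)
      then have "v s \<noteq> 0" by auto
      from has_real_derivative_norm_line[OF this, of "w s"] show ?case by simp
    qed
    show "AE s in M. \<bar>norm (v s + x *\<^sub>R w s + 0 *\<^sub>R z s) - norm (v s + 0 *\<^sub>R w s + 0 *\<^sub>R z s)\<bar> \<le> C * \<bar>x - 0\<bar>" for x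
      using w
    proof eventually_elim
      case (elim s)
      have "\<bar>norm (v s + x *\<^sub>R w s) - norm (v s)\<bar> \<le> norm (x *\<^sub>R w s)"
        using norm_triangle_ineq3[of "v s + x *\<^sub>R w s" "v s"] by simp
      also have "\<dots> \<le> C * \<bar>x\<bar>" using mult_right_mono[OF elim abs_ge_zero[of x]] by (simp add: mult.commute)
      finally show ?case by simp
    qed
  qed measurable
  have D12: "((\<lambda>x. integral\<^sup>L M (\<lambda>s. ((v s + x *\<^sub>R w s) \<bullet> z s) / norm (v s + x *\<^sub>R w s))) has_real_derivative
      integral\<^sup>L M (\<lambda>s. (w s \<bullet> z s) / norm (v s) - (v s \<bullet> w s) * (v s \<bullet> z s) / norm (v s) ^ 3)) (at 0)"
  proof (rule has_real_derivative_integral[OF M _ _ _ r, where K = "4 * C * C"])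
    \<comment> \<open>Integrability is required for every \<open>x\<close>, including those for
      which the vector in the denominator may vanish; the quotient is then 0 by the convention for
      division, so the bound by \<open>C\<close> persists.\<close>
    show "integrable M (\<lambda>s. ((v s + x *\<^sub>R w s) \<bullet> z s) / norm (v s + x *\<^sub>R w s))" for x
    proof (rule integrable_const_bound)
      show "AE s in M. norm (((v s + x *\<^sub>R w s) \<bullet> z s) / norm (v s + x *\<^sub>R w s)) \<le> C"
        using z
      proof eventually_elim
        case (elim s)
        let ?p = "v s + x *\<^sub>R w s"
        have "\<bar>?p \<bullet> z s\<bar> \<le> norm ?p * C"
          using Cauchy_Schwarz_ineq2[of ?p "z s"] mult_left_mono[OF elim norm_ge_zero[of ?p]] by linarith
        then show ?case using C by (cases "norm ?p = 0") (auto simp: divide_le_eq mult.commute)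
      qed
    qed measurable
    show "AE s in M. ((\<lambda>x. ((v s + x *\<^sub>R w s) \<bullet> z s) / norm (v s + x *\<^sub>R w s)) has_real_derivative
        (w s \<bullet> z s) / norm (v s) - (v s \<bullet> w s) * (v s \<bullet> z s) / norm (v s) ^ 3) (at 0)"
      using v by eventually_elim (rule has_real_derivative_norm_line_inner, auto)
    show "AE s in M. \<bar>((v s + x *\<^sub>R w s) \<bullet> z s) / norm (v s + x *\<^sub>R w s)
        - ((v s + 0 *\<^sub>R w s) \<bullet> z s) / norm (v s + 0 *\<^sub>R w s)\<bar> \<le> 4 * C * C * \<bar>x - 0\<bar>"
      if "\<bar>x - 0\<bar> < ?r" for x
      using v w z
    proof eventually_elim
      case (elim s)
      from sgn_inner_lipschitz[OF elim C, of x] that elim(1) show ?case by simp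
    qed
  qed measurable
  from eventually_abs_less[OF r] have "\<forall>\<^sub>F x in nhds 0. ((\<lambda>y. integral\<^sup>L M (\<lambda>s. norm (v s + x *\<^sub>R w s + y *\<^sub>R z s))) has_real_derivative
      integral\<^sup>L M (\<lambda>s. ((v s + x *\<^sub>R w s) \<bullet> z s) / norm (v s + x *\<^sub>R w s))) (at 0)"
    by eventually_elim (rule Dn)
  then show ?thesis unfolding second_order_def
    by (intro exI conjI) (assumption, rule D1, rule D12)
qed

section \<open>Chord and arc\<close>

lemma pos_arc_Icc:
  assumes "0 < L" obtains d where "pos_arc L a b = {a..a + d}" "0 \<le> d" "d < L"
    "\<exists>k::int. a + d = b + of_int k * L"
proof
  let ?d = "L * frac ((b - a) / L)"
  show "pos_arc L a b = {a..a + ?d}" by (simp add: pos_arc_def)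
  show "0 \<le> ?d" "?d < L" using assms by (simp_all add: frac_lt_1)
  have "a + ?d = b + of_int (- \<lfloor>(b - a) / L\<rfloor>) * L"
    using assms by (simp add: frac_def field_simps)
  then show "\<exists>k::int. a + ?d = b + of_int k * L" by blast
qed

lemma tangent_pair_expand:
  "(norm (tangent g s - tangent g t))\<^sup>2 * line_elt g s * line_elt g t
    = 2 * line_elt g s * line_elt g t - 2 * (velocity g s \<bullet> velocity g t)"
proof (cases "velocity g s = 0 \<or> velocity g t = 0")
  case True
  then show ?thesis by (auto simp: line_elt_def)
next
  case False
  define V W where "V = velocity g s" and "W = velocity g t"
  have nz: "norm V \<noteq> 0" "norm W \<noteq> 0" using False by (auto simp: V_def W_def)
  have "norm (V /\<^sub>R norm V) = 1" "norm (W /\<^sub>R norm W) = 1" using nz by simp_all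
  with dot_norm_neg[of "V /\<^sub>R norm V" "W /\<^sub>R norm W"]
  have "(norm (V /\<^sub>R norm V - W /\<^sub>R norm W))\<^sup>2 = 2 - 2 * ((V /\<^sub>R norm V) \<bullet> (W /\<^sub>R norm W))"
    by simp
  also have "(V /\<^sub>R norm V) \<bullet> (W /\<^sub>R norm W) = (V \<bullet> W) / (norm V * norm W)"
    by (simp add: field_simps)
  finally have "(norm (V /\<^sub>R norm V - W /\<^sub>R norm W))\<^sup>2 = 2 - 2 * ((V \<bullet> W) / (norm V * norm W))" .
  then show ?thesis
    using nz unfolding tangent_def line_elt_def V_def[symmetric] W_def[symmetric]
    by (simp only: left_diff_distrib) simp
qed

lemma arc_length_eq_integral:
  assumes "lipschitz_loop L g" "a \<le> b"
  shows "arc_length g {a..b} = integral {a..b} (line_elt g)"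
    and "line_elt g absolutely_integrable_on {a..b}"
proof -
  have "velocity g absolutely_integrable_on {a..b}" using assms by (simp add: lipschitz_loop_def)
  then show i: "line_elt g absolutely_integrable_on {a..b}"
    unfolding line_elt_def by (rule absolutely_integrable_norm[unfolded o_def])
  show "arc_length g {a..b} = integral {a..b} (line_elt g)"
    unfolding arc_length_def by (rule set_lebesgue_integral_eq_integral(2)[OF i])
qed

lemma norm_diff_le_arc_length:
  assumes "lipschitz_loop L g" "a \<le> b"
  shows "norm (g b - g a) \<le> arc_length g {a..b}"
proof -
  have v: "velocity g absolutely_integrable_on {a..b}" "integral {a..b} (velocity g) = g b - g a"
    using assms by (auto simp: lipschitz_loop_def)
  have "norm (integral {a..b} (velocity g)) \<le> integral {a..b} (line_elt g)"
    by (rule integral_norm_bound_integral)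
       (use v(1) arc_length_eq_integral(2)[OF assms] in \<open>auto simp: line_elt_def dest: set_lebesgue_integral_eq_integral(1)\<close>)
  then show ?thesis by (simp add: v(2) arc_length_eq_integral(1)[OF assms])
qed

text \<open>After the expansion both variables separate: the line elements contribute the square of
  the length, and the velocities integrate to the chord vector, so their inner product contributes
  its squared norm.\<close>

lemma tangent_double_integral:
  fixes g :: "real \<Rightarrow> real ^ 'n"
  assumes g: "lipschitz_loop L g" and ab: "a \<le> b"
  shows "(LINT s:{a..b}|lebesgue. LINT t:{a..b}|lebesgue.
      (norm (tangent g s - tangent g t))\<^sup>2 * line_elt g s * line_elt g t)
    = 2 * (arc_length g {a..b})\<^sup>2 - 2 * (norm (g b - g a))\<^sup>2"
proof -
  let ?A = "{a..b}" and ?D = "arc_length g {a..b}" and ?d = "g b - g a"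
  have v: "velocity g absolutely_integrable_on ?A" and vi: "integral ?A (velocity g) = ?d"
    using g ab by (auto simp: lipschitz_loop_def)
  have vL: "(LINT t:?A|lebesgue. velocity g t) = ?d"
    using set_lebesgue_integral_eq_integral(2)[OF v] vi by simp
  have l: "line_elt g absolutely_integrable_on ?A" by (rule arc_length_eq_integral(2)[OF g ab])
  have lL: "(LINT t:?A|lebesgue. line_elt g t) = ?D" by (simp add: arc_length_def)
  have iv: "set_integrable lebesgue ?A (\<lambda>t. x \<bullet> velocity g t)"
    and iv': "(LINT t:?A|lebesgue. x \<bullet> velocity g t) = x \<bullet> ?d" for x
  proof -
    have eq: "(\<lambda>t. indicat_real ?A t *\<^sub>R (x \<bullet> velocity g t)) = (\<lambda>t. x \<bullet> (indicat_real ?A t *\<^sub>R velocity g t))"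
      by simp
    show "set_integrable lebesgue ?A (\<lambda>t. x \<bullet> velocity g t)"
      using v unfolding set_integrable_def eq by (rule integrable_inner_right)
    show "(LINT t:?A|lebesgue. x \<bullet> velocity g t) = x \<bullet> ?d"
      using v vL unfolding set_lebesgue_integral_def set_integrable_def eq by (subst integral_inner_right) auto
  qed
  have inner: "(LINT t:?A|lebesgue. (norm (tangent g s - tangent g t))\<^sup>2 * line_elt g s * line_elt g t)
      = 2 * ?D * line_elt g s - 2 * (?d \<bullet> velocity g s)" for s
  proof -
    have "(LINT t:?A|lebesgue. (2 * line_elt g s) * line_elt g t - 2 * (velocity g s \<bullet> velocity g t))
        = (LINT t:?A|lebesgue. (2 * line_elt g s) * line_elt g t)
          - (LINT t:?A|lebesgue. 2 * (velocity g s \<bullet> velocity g t))"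
      using l iv by (intro set_integral_diff) auto
    then show ?thesis
      unfolding tangent_pair_expand set_integral_mult_right lL iv' by (simp add: inner_commute)
  qed
  have "(LINT s:?A|lebesgue. 2 * ?D * line_elt g s - 2 * (?d \<bullet> velocity g s))
      = (LINT s:?A|lebesgue. 2 * ?D * line_elt g s) - (LINT s:?A|lebesgue. 2 * (?d \<bullet> velocity g s))"
    using l iv by (intro set_integral_diff) auto
  then show ?thesis
    unfolding inner by (simp add: lL iv' dot_square_norm power2_eq_square)
qed

lemma phi_a_ratio:
  assumes "0 < d" "0 < D"
  shows "phi_a \<alpha> (D\<^sup>2 / d\<^sup>2 - 1) / d powr \<alpha> = 1 / d powr \<alpha> - 1 / D powr \<alpha>"
proof -
  have "(1 + (D\<^sup>2 / d\<^sup>2 - 1)) powr (\<alpha> / 2) = (D / d) powr \<alpha>"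
  proof -
    have "1 + (D\<^sup>2 / d\<^sup>2 - 1) = (D / d) powr 2" using assms by (simp add: power_divide)
    then show ?thesis by (simp add: powr_powr)
  qed
  also have "\<dots> = D powr \<alpha> / d powr \<alpha>" using assms by (simp add: powr_divide)
  finally show ?thesis using assms by (simp add: phi_a_def field_simps)
qed

text \<open>\<open>a\<close> and \<open>b\<close> are the end points of the short arc, in either orientation.\<close>

lemma M_a_eq:
  fixes g :: "real \<Rightarrow> real ^ 'n"
  assumes g: "lipschitz_loop L g" and arc: "short_arc L g s\<^sub>1 s\<^sub>2 = {a..b}" and ab: "a \<le> b"
    and chord: "norm (g b - g a) = norm (g s\<^sub>1 - g s\<^sub>2)" and pos: "g s\<^sub>1 \<noteq> g s\<^sub>2"
  shows "M_a L \<alpha> g s\<^sub>1 s\<^sub>2 = 1 / norm (g s\<^sub>1 - g s\<^sub>2) powr \<alpha> - 1 / arc_length g {a..b} powr \<alpha>"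
proof -
  have d: "0 < norm (g s\<^sub>1 - g s\<^sub>2)" using pos by simp
  have D: "0 < arc_length g {a..b}" using norm_diff_le_arc_length[OF g ab] d unfolding chord by linarith
  have "N_tau L g s\<^sub>1 s\<^sub>2 = (arc_length g {a..b})\<^sup>2 / (norm (g s\<^sub>1 - g s\<^sub>2))\<^sup>2 - 1"
    unfolding N_tau_def arc tangent_double_integral[OF g ab] chord using d by (simp add: field_simps)
  then show ?thesis unfolding M_a_def by (simp add: phi_a_ratio[OF d D])
qed

lemma intrinsic_dist_short_arc: "intrinsic_dist L g s\<^sub>1 s\<^sub>2 = arc_length g (short_arc L g s\<^sub>1 s\<^sub>2)"
  by (simp add: intrinsic_dist_def short_arc_def)

lemma powr_diff_nonneg:
  assumes "0 < d" "d \<le> D" "0 < \<alpha>"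
  shows "0 \<le> 1 / d powr \<alpha> - 1 / D powr (\<alpha> :: real)"
  using assms by (simp add: frac_le powr_mono2)

section \<open>Perturbed curves\<close>

abbreviation perturb :: "(real \<Rightarrow> real ^ 'n) \<Rightarrow> (real \<Rightarrow> real ^ 'n) \<Rightarrow> (real \<Rightarrow> real ^ 'n) \<Rightarrow> real \<Rightarrow> real \<Rightarrow> real \<Rightarrow> real ^ 'n" where
  "perturb f \<phi> \<psi> x y \<equiv> (\<lambda>s. f s + x *\<^sub>R \<phi> s + y *\<^sub>R \<psi> s)"

lemma lipschitz_loop_perturb:
  "lipschitz_loop L f \<Longrightarrow> lipschitz_loop L \<phi> \<Longrightarrow> lipschitz_loop L \<psi> \<Longrightarrow> lipschitz_loop L (perturb f \<phi> \<psi> x y)"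
  by (intro lipschitz_loop_add_scaleR)

lemma velocity_perturb:
  assumes "(f has_vector_derivative velocity f s) (at s)" "(\<phi> has_vector_derivative velocity \<phi> s) (at s)"
    "(\<psi> has_vector_derivative velocity \<psi> s) (at s)"
  shows "velocity (perturb f \<phi> \<psi> x y) s = velocity f s + x *\<^sub>R velocity \<phi> s + y *\<^sub>R velocity \<psi> s"
proof -
  have "((\<lambda>s. f s + x *\<^sub>R \<phi> s) has_vector_derivative velocity (\<lambda>s. f s + x *\<^sub>R \<phi> s) s) (at s)"
    unfolding velocity_add_scaleR(2)[OF assms(1,2)] by (rule velocity_add_scaleR(1)[OF assms(1,2)])
  from velocity_add_scaleR(2)[OF this assms(3), of y] show ?thesis
    by (simp only: velocity_add_scaleR(2)[OF assms(1,2)])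
qed

text \<open>Off a negligible set the perturbed velocity is affine in the parameters, which is the
  form \<open>second_order_integral_norm\<close> requires. The second claim controls the change of
  length, so that a strict comparison of two arcs survives small perturbations.\<close>

lemma arc_length_perturb:
  fixes f \<phi> \<psi> :: "real \<Rightarrow> real ^ 'n"
  assumes loops: "lipschitz_loop L f" "lipschitz_loop L \<phi>" "lipschitz_loop L \<psi>" and ab: "a \<le> b"
  shows "arc_length (perturb f \<phi> \<psi> x y) {a..b} =
    integral\<^sup>L (lebesgue_on {a..b}) (\<lambda>s. norm (velocity f s + x *\<^sub>R velocity \<phi> s + y *\<^sub>R velocity \<psi> s))"
    and "\<bar>arc_length (perturb f \<phi> \<psi> x y) {a..b} - arc_length f {a..b}\<bar>
      \<le> \<bar>x\<bar> * arc_length \<phi> {a..b} + \<bar>y\<bar> * arc_length \<psi> {a..b}"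
proof -
  let ?h = "\<lambda>s. norm (velocity f s + x *\<^sub>R velocity \<phi> s + y *\<^sub>R velocity \<psi> s)"
  have v: "velocity f absolutely_integrable_on {a..b}" "velocity \<phi> absolutely_integrable_on {a..b}"
    "velocity \<psi> absolutely_integrable_on {a..b}"
    using loops ab by (auto simp: lipschitz_loop_def)
  have "(\<lambda>s. velocity f s + x *\<^sub>R velocity \<phi> s + y *\<^sub>R velocity \<psi> s) absolutely_integrable_on {a..b}"
    by (intro set_integral_add absolutely_integrable_scaleR_left v)
  then have h: "?h absolutely_integrable_on {a..b}" by (rule absolutely_integrable_norm[unfolded o_def])
  from loops[THEN lipschitz_loop_AE_derivative] have "AE s in lebesgue. line_elt (perturb f \<phi> \<psi> x y) s = ?h s"
    by eventually_elim (simp add: line_elt_def velocity_perturb)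
  then have N: "negligible {s. line_elt (perturb f \<phi> \<psi> x y) s \<noteq> ?h s}"
    by (simp only: AE_lebesgue_negligible_iff)
  have "arc_length (perturb f \<phi> \<psi> x y) {a..b} = integral {a..b} (line_elt (perturb f \<phi> \<psi> x y))"
    by (rule arc_length_eq_integral(1)[OF lipschitz_loop_perturb[OF loops] ab])
  also have "\<dots> = integral {a..b} ?h"
    by (rule integral_spike[OF N]) simp
  finally have 1: "arc_length (perturb f \<phi> \<psi> x y) {a..b} = integral {a..b} ?h" .
  have "integral\<^sup>L (lebesgue_on {a..b}) ?h = (LINT s:{a..b}|lebesgue. ?h s)"
    unfolding set_lebesgue_integral_def by (rule integral_restrict_space) simp
  also have "\<dots> = integral {a..b} ?h" by (rule set_lebesgue_integral_eq_integral(2)[OF h])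
  finally show "arc_length (perturb f \<phi> \<psi> x y) {a..b} = integral\<^sup>L (lebesgue_on {a..b}) ?h"
    using 1 by simp
  have le: "line_elt u integrable_on {a..b}" if "lipschitz_loop L u" for u :: "real \<Rightarrow> real ^ 'n"
    by (rule set_lebesgue_integral_eq_integral(1)[OF arc_length_eq_integral(2)[OF that ab]])
  have hi: "?h integrable_on {a..b}" by (rule set_lebesgue_integral_eq_integral(1)[OF h])
  have bd: "norm (?h s - line_elt f s) \<le> \<bar>x\<bar> * line_elt \<phi> s + \<bar>y\<bar> * line_elt \<psi> s" for s
  proof -
    have "\<bar>?h s - norm (velocity f s)\<bar> \<le> norm (x *\<^sub>R velocity \<phi> s + y *\<^sub>R velocity \<psi> s)"
      using norm_triangle_ineq3[of "velocity f s + x *\<^sub>R velocity \<phi> s + y *\<^sub>R velocity \<psi> s" "velocity f s"]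
      by (simp add: add.assoc)
    also have "\<dots> \<le> \<bar>x\<bar> * line_elt \<phi> s + \<bar>y\<bar> * line_elt \<psi> s"
      using norm_triangle_ineq[of "x *\<^sub>R velocity \<phi> s" "y *\<^sub>R velocity \<psi> s"] by (simp add: line_elt_def)
    finally show ?thesis by (simp add: line_elt_def)
  qed
  have i1: "((\<lambda>s. ?h s - line_elt f s) has_integral integral {a..b} ?h - arc_length f {a..b}) {a..b}"
    unfolding arc_length_eq_integral(1)[OF loops(1) ab]
    by (intro has_integral_diff integrable_integral hi le loops)
  have i2: "((\<lambda>s. \<bar>x\<bar> * line_elt \<phi> s + \<bar>y\<bar> * line_elt \<psi> s) has_integral
      \<bar>x\<bar> * arc_length \<phi> {a..b} + \<bar>y\<bar> * arc_length \<psi> {a..b}) {a..b}"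
    unfolding arc_length_eq_integral(1)[OF loops(2) ab] arc_length_eq_integral(1)[OF loops(3) ab]
    by (intro has_integral_add has_integral_mult_right integrable_integral le loops)
  have "norm (integral {a..b} (\<lambda>s. ?h s - line_elt f s)) \<le> integral {a..b} (\<lambda>s. \<bar>x\<bar> * line_elt \<phi> s + \<bar>y\<bar> * line_elt \<psi> s)"
    by (rule integral_norm_bound_integral[OF has_integral_integrable[OF i1] has_integral_integrable[OF i2] bd])
  then show "\<bar>arc_length (perturb f \<phi> \<psi> x y) {a..b} - arc_length f {a..b}\<bar>
      \<le> \<bar>x\<bar> * arc_length \<phi> {a..b} + \<bar>y\<bar> * arc_length \<psi> {a..b}"
    unfolding integral_unique[OF i1] integral_unique[OF i2] 1 real_norm_def .
qed

lemma arc_length_nonneg: "0 \<le> arc_length g A"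
  unfolding arc_length_def set_lebesgue_integral_def
  by (rule integral_nonneg_AE) (simp add: line_elt_def)

lemma exists_small_radius:
  assumes "0 \<le> K" "0 < (e::real)"
  obtains r where "0 < r" "\<And>x y. \<bar>x\<bar> < r \<Longrightarrow> \<bar>y\<bar> < r \<Longrightarrow> (\<bar>x\<bar> + \<bar>y\<bar>) * K < e"
proof
  \<comment> \<open>The summand 1 avoids division by zero for \<open>K = 0\<close> and makes the
    final inequality strict; the half distributes the bound over the two parameters.\<close>
  show "0 < e / (K + 1) / 2" using assms by simp
  fix x y :: real assume "\<bar>x\<bar> < e / (K + 1) / 2" "\<bar>y\<bar> < e / (K + 1) / 2"
  then have "\<bar>x\<bar> + \<bar>y\<bar> \<le> e / (K + 1)" by linarith
  then have "(\<bar>x\<bar> + \<bar>y\<bar>) * K \<le> e / (K + 1) * K" using assms(1) by (rule mult_right_mono)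
  also have "\<dots> < e" using assms by (simp add: pos_divide_less_eq distrib_left)
  finally show "(\<bar>x\<bar> + \<bar>y\<bar>) * K < e" .
qed

lemma AE_norm_velocity:
  assumes "arclength_param L f" shows "AE s in lebesgue. norm (velocity f s) = 1"
proof -
  have "AE s in lebesgue. \<exists>t. (f has_vector_derivative t) (at s) \<and> norm t = 1"
    using assms by (simp add: arclength_param_def)
  then show ?thesis by eventually_elim (auto simp: velocity_eq)
qed

lemma arc_length_arclength_param:
  assumes "lipschitz_loop L f" "arclength_param L f" "a \<le> b"
  shows "arc_length f {a..b} = b - a"
proof -
  have N: "negligible {s. \<not> norm (velocity f s) = 1}"
    using AE_norm_velocity[OF assms(2)] by (simp only: AE_lebesgue_negligible_iff)
  have "arc_length f {a..b} = integral {a..b} (line_elt f)"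
    by (rule arc_length_eq_integral(1)[OF assms(1,3)])
  also have "\<dots> = integral {a..b} (\<lambda>s. 1)"
    by (rule integral_spike[OF N]) (simp add: line_elt_def)
  finally show ?thesis using assms(3) by simp
qed

text \<open>The radius is chosen so that the changes of both arc lengths together stay below the gap
  \<open>\<bar>d - e\<bar>\<close>. The arc may start at either parameter and its end points match
  \<open>s\<^sub>1\<close> and \<open>s\<^sub>2\<close> only modulo \<open>L\<close>, so the chords
  are compared through their norms, for periodic maps.\<close>

lemma short_arc_stable:
  fixes f \<phi> \<psi> :: "real \<Rightarrow> real ^ 'n"
  assumes L: "0 < L" and loops: "lipschitz_loop L f" "lipschitz_loop L \<phi>" "lipschitz_loop L \<psi>"
    and f: "arclength_param L f" and s: "\<And>k::int. s\<^sub>1 - s\<^sub>2 \<noteq> of_int k * (L / 2)"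
  obtains a b r where "a < b" "0 < r"
    "\<forall>x y. \<bar>x\<bar> < r \<longrightarrow> \<bar>y\<bar> < r \<longrightarrow> short_arc L (perturb f \<phi> \<psi> x y) s\<^sub>1 s\<^sub>2 = {a..b}"
    "\<forall>g :: real \<Rightarrow> real ^ 'n. periodic L g \<longrightarrow> norm (g b - g a) = norm (g s\<^sub>1 - g s\<^sub>2)"
proof -
  obtain d k where A: "pos_arc L s\<^sub>2 s\<^sub>1 = {s\<^sub>2..s\<^sub>2 + d}" "0 \<le> d" "s\<^sub>2 + d = s\<^sub>1 + of_int k * L"
    using pos_arc_Icc[OF L, of s\<^sub>2 s\<^sub>1] by metis
  obtain e j where B: "pos_arc L s\<^sub>1 s\<^sub>2 = {s\<^sub>1..s\<^sub>1 + e}" "0 \<le> e" "s\<^sub>1 + e = s\<^sub>2 + of_int j * L"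
    using pos_arc_Icc[OF L, of s\<^sub>1 s\<^sub>2] by metis
  have d: "0 < d" using s[of "- 2 * k"] A(2,3) by (auto simp: less_le algebra_simps)
  have e: "0 < e" using s[of "2 * j"] B(2,3) by (auto simp: less_le algebra_simps)
  \<comment> \<open>Equal arcs would make twice \<open>s\<^sub>1 - s\<^sub>2\<close> a multiple of
    \<open>L\<close>; this is where the half period enters.\<close>
  have ne: "d \<noteq> e"
  proof
    assume "d = e"
    then have "s\<^sub>1 - s\<^sub>2 = of_int (j - k) * (L / 2)"
      using A(3) B(3) by (simp add: field_simps)
    with s show False by blast
  qed
  let ?K = "\<lambda>X. arc_length \<phi> X + arc_length \<psi> X"
  let ?A = "{s\<^sub>2..s\<^sub>2 + d}" and ?B = "{s\<^sub>1..s\<^sub>1 + e}"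
  have "0 \<le> ?K ?A + ?K ?B" by (intro add_nonneg_nonneg arc_length_nonneg)
  then obtain r where r: "0 < r" "\<And>x y. \<bar>x\<bar> < r \<Longrightarrow> \<bar>y\<bar> < r \<Longrightarrow> (\<bar>x\<bar> + \<bar>y\<bar>) * (?K ?A + ?K ?B) < \<bar>d - e\<bar>"
    using exists_small_radius[of "?K ?A + ?K ?B" "\<bar>d - e\<bar>"] ne by auto
  have diff: "\<bar>(arc_length (perturb f \<phi> \<psi> x y) ?A - arc_length (perturb f \<phi> \<psi> x y) ?B) - (d - e)\<bar> < \<bar>d - e\<bar>"
    if xy: "\<bar>x\<bar> < r" "\<bar>y\<bar> < r" for x y
  proof -
    have bd: "\<bar>arc_length (perturb f \<phi> \<psi> x y) {a..a + c} - c\<bar> \<le> (\<bar>x\<bar> + \<bar>y\<bar>) * ?K {a..a + c}" if "0 \<le> c" for a c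
    proof -
      have "\<bar>arc_length (perturb f \<phi> \<psi> x y) {a..a + c} - arc_length f {a..a + c}\<bar>
          \<le> \<bar>x\<bar> * arc_length \<phi> {a..a + c} + \<bar>y\<bar> * arc_length \<psi> {a..a + c}"
        by (rule arc_length_perturb(2)[OF loops]) (use that in simp)
      moreover have "arc_length f {a..a + c} = c"
        using arc_length_arclength_param[OF loops(1) f, of a "a + c"] that by simp
      moreover have "0 \<le> \<bar>x\<bar> * arc_length \<psi> {a..a + c}" "0 \<le> \<bar>y\<bar> * arc_length \<phi> {a..a + c}"
        by (intro mult_nonneg_nonneg arc_length_nonneg abs_ge_zero)+
      ultimately show ?thesis by (simp add: algebra_simps)
    qed
    have "(\<bar>x\<bar> + \<bar>y\<bar>) * ?K ?A + (\<bar>x\<bar> + \<bar>y\<bar>) * ?K ?B < \<bar>d - e\<bar>"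
      using r(2)[OF xy] by (simp only: distrib_left)
    then show ?thesis using bd[of d s\<^sub>2] bd[of e s\<^sub>1] A(2) B(2) by linarith
  qed
  show thesis
  proof (cases "d < e")
    case True
    show thesis
    proof (rule that[of s\<^sub>2 "s\<^sub>2 + d" r])
      show "\<forall>x y. \<bar>x\<bar> < r \<longrightarrow> \<bar>y\<bar> < r \<longrightarrow> short_arc L (perturb f \<phi> \<psi> x y) s\<^sub>1 s\<^sub>2 = ?A"
      proof (intro allI impI)
        fix x y :: real assume xy: "\<bar>x\<bar> < r" "\<bar>y\<bar> < r"
        have "arc_length (perturb f \<phi> \<psi> x y) ?A \<le> arc_length (perturb f \<phi> \<psi> x y) ?B"
          using diff[OF xy] True by linarith
        then show "short_arc L (perturb f \<phi> \<psi> x y) s\<^sub>1 s\<^sub>2 = ?A" by (simp only: short_arc_def A(1) B(1) if_True)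
      qed
      show "\<forall>g :: real \<Rightarrow> real ^ 'n. periodic L g \<longrightarrow> norm (g (s\<^sub>2 + d) - g s\<^sub>2) = norm (g s\<^sub>1 - g s\<^sub>2)"
        by (simp add: A(3) periodic_int)
    qed (use d r in auto)
  next
    case False
    show thesis
    proof (rule that[of s\<^sub>1 "s\<^sub>1 + e" r])
      show "\<forall>x y. \<bar>x\<bar> < r \<longrightarrow> \<bar>y\<bar> < r \<longrightarrow> short_arc L (perturb f \<phi> \<psi> x y) s\<^sub>1 s\<^sub>2 = ?B"
      proof (intro allI impI)
        fix x y :: real assume xy: "\<bar>x\<bar> < r" "\<bar>y\<bar> < r"
        \<comment> \<open>A tie in \<open>short_arc\<close> would select the other arc, so a strict
          inequality is required; the strict bound \<open>diff\<close> supplies it.\<close>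
        have "\<not> arc_length (perturb f \<phi> \<psi> x y) ?A \<le> arc_length (perturb f \<phi> \<psi> x y) ?B"
          using diff[OF xy] False by linarith
        then show "short_arc L (perturb f \<phi> \<psi> x y) s\<^sub>1 s\<^sub>2 = ?B" by (simp only: short_arc_def A(1) B(1) if_False)
      qed
      show "\<forall>g :: real \<Rightarrow> real ^ 'n. periodic L g \<longrightarrow> norm (g (s\<^sub>1 + e) - g s\<^sub>1) = norm (g s\<^sub>1 - g s\<^sub>2)"
        by (simp add: B(3) periodic_int norm_minus_commute)
    qed (use e r in auto)
  qed
qed

lemma second_order_arc_length:
  fixes f \<phi> \<psi> :: "real \<Rightarrow> real ^ 'n"
  assumes loops: "lipschitz_loop L f" "lipschitz_loop L \<phi>" "lipschitz_loop L \<psi>"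
    and f: "arclength_param L f" and ab: "a \<le> b"
  shows "\<exists>d\<^sub>1 d\<^sub>2 d\<^sub>1\<^sub>2. second_order (\<lambda>x y. arc_length (perturb f \<phi> \<psi> x y) {a..b}) d\<^sub>1 d\<^sub>2 d\<^sub>1\<^sub>2"
  unfolding arc_length_perturb(1)[OF loops ab]
proof -
  have AE_on: "AE s in lebesgue_on {a..b}. P s" if "AE s in lebesgue. P s" for P
    using that by (simp add: AE_restrict_space_iff) (erule eventually_mono, simp)
  obtain C where C: "0 \<le> C" "AE s in lebesgue. (\<phi> has_vector_derivative velocity \<phi> s) (at s) \<and> norm (velocity \<phi> s) \<le> C"
    using lipschitz_loop_AE[OF loops(2)] .
  obtain D where D: "0 \<le> D" "AE s in lebesgue. (\<psi> has_vector_derivative velocity \<psi> s) (at s) \<and> norm (velocity \<psi> s) \<le> D"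
    using lipschitz_loop_AE[OF loops(3)] .
  have meas: "velocity u \<in> borel_measurable (lebesgue_on {a..b})" if "lipschitz_loop L u" for u :: "real \<Rightarrow> real ^ 'n"
  proof -
    have "velocity u absolutely_integrable_on {a..b}" using that ab by (simp add: lipschitz_loop_def)
    then have "integrable (lebesgue_on {a..b}) (velocity u)"
      by (simp add: set_integrable_def integrable_restrict_space)
    then show ?thesis by (rule borel_measurable_integrable)
  qed
  show "\<exists>d\<^sub>1 d\<^sub>2 d\<^sub>1\<^sub>2. second_order (\<lambda>x y. integral\<^sup>L (lebesgue_on {a..b})
      (\<lambda>s. norm (velocity f s + x *\<^sub>R velocity \<phi> s + y *\<^sub>R velocity \<psi> s))) d\<^sub>1 d\<^sub>2 d\<^sub>1\<^sub>2"
  proof (rule second_order_integral_norm[where C = "max C D"])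
    show "finite_measure (lebesgue_on {a..b})" by (rule finite_measure_lebesgue_on) simp
    show "velocity f \<in> borel_measurable (lebesgue_on {a..b})"
      "velocity \<phi> \<in> borel_measurable (lebesgue_on {a..b})"
      "velocity \<psi> \<in> borel_measurable (lebesgue_on {a..b})"
      by (rule meas, rule loops)+
    show "AE s in lebesgue_on {a..b}. norm (velocity f s) = 1"
      by (rule AE_on[OF AE_norm_velocity[OF f]])
    show "AE s in lebesgue_on {a..b}. norm (velocity \<phi> s) \<le> max C D"
      by (rule AE_on[OF eventually_mono[OF C(2)]]) auto
    show "AE s in lebesgue_on {a..b}. norm (velocity \<psi> s) \<le> max C D"
      by (rule AE_on[OF eventually_mono[OF D(2)]]) auto
    show "0 \<le> max C D" using C(1) by simp
  qed
qed

text \<open>The conditions imposed on the two parameters are those satisfied by almost every pair.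
  They allow everything near the curve to be written through the chord \<open>q\<close> and the
  length \<open>D\<close> of one fixed parameter interval.\<close>

lemma variation_at_regular_point:
  fixes f \<phi> \<psi> :: "real \<Rightarrow> real ^ 'n"
  assumes L: "0 < L" and \<alpha>: "0 < \<alpha>" and p: "1 \<le> p"
    and f: "arclength_param L f" "bi_Lipschitz L f"
    and loops: "lipschitz_loop L f" "lipschitz_loop L \<phi>" "lipschitz_loop L \<psi>"
    and diff: "\<And>s. s \<in> {s\<^sub>1, s\<^sub>2} \<Longrightarrow> (f has_vector_derivative velocity f s) (at s)"
      "\<And>s. s \<in> {s\<^sub>1, s\<^sub>2} \<Longrightarrow> (\<phi> has_vector_derivative velocity \<phi> s) (at s)"
      "\<And>s. s \<in> {s\<^sub>1, s\<^sub>2} \<Longrightarrow> (\<psi> has_vector_derivative velocity \<psi> s) (at s)"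
    and unit: "\<And>s. s \<in> {s\<^sub>1, s\<^sub>2} \<Longrightarrow> norm (velocity f s) = 1"
    and s: "\<And>k::int. s\<^sub>1 - s\<^sub>2 \<noteq> of_int k * (L / 2)"
  shows "has_var1 (\<lambda>g. M_a L \<alpha> g s\<^sub>1 s\<^sub>2) f \<phi> \<and>
    has_var1 (\<lambda>g. M_a L \<alpha> g s\<^sub>1 s\<^sub>2) f \<psi> \<and>
    has_var2 (\<lambda>g. M_a L \<alpha> g s\<^sub>1 s\<^sub>2) f \<phi> \<psi> \<and>
    has_var1 (\<lambda>g. M_density L \<alpha> p g s\<^sub>1 s\<^sub>2) f \<phi> \<and>
    has_var2 (\<lambda>g. M_density L \<alpha> p g s\<^sub>1 s\<^sub>2) f \<phi> \<psi> \<and>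
    G_ap L \<alpha> p f \<phi> s\<^sub>1 s\<^sub>2 = G1 L \<alpha> p f \<phi> s\<^sub>1 s\<^sub>2 + G2 L \<alpha> p f \<phi> s\<^sub>1 s\<^sub>2 \<and>
    H_ap L \<alpha> p f \<phi> \<psi> s\<^sub>1 s\<^sub>2 =
      H1 L \<alpha> p f \<phi> \<psi> s\<^sub>1 s\<^sub>2 + H2 L \<alpha> p f \<phi> \<psi> s\<^sub>1 s\<^sub>2 + H3 L \<alpha> p f \<phi> \<psi> s\<^sub>1 s\<^sub>2 +
      H4 L \<alpha> p f \<phi> \<psi> s\<^sub>1 s\<^sub>2 + H5 L \<alpha> p f \<phi> \<psi> s\<^sub>1 s\<^sub>2 + H6 L \<alpha> p f \<phi> \<psi> s\<^sub>1 s\<^sub>2"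
proof -
  let ?g = "perturb f \<phi> \<psi>"
  have g: "lipschitz_loop L (?g x y)" for x y by (rule lipschitz_loop_perturb[OF loops])
  obtain a b r where ab: "a < b" and r: "0 < r"
    and arc': "\<forall>x y. \<bar>x\<bar> < r \<longrightarrow> \<bar>y\<bar> < r \<longrightarrow> short_arc L (?g x y) s\<^sub>1 s\<^sub>2 = {a..b}"
    and chord': "\<forall>g :: real \<Rightarrow> real ^ 'n. periodic L g \<longrightarrow> norm (g b - g a) = norm (g s\<^sub>1 - g s\<^sub>2)"
    by (rule short_arc_stable[OF L loops f(1) s])
  note arc = arc'[rule_format] and chord = chord'[rule_format]
  have ab': "a \<le> b" using ab by simp
  define P Q R where "P = f s\<^sub>1 - f s\<^sub>2" and "Q = \<phi> s\<^sub>1 - \<phi> s\<^sub>2" and "R = \<psi> s\<^sub>1 - \<psi> s\<^sub>2"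
  have chord_eq: "?g x y s\<^sub>1 - ?g x y s\<^sub>2 = P + x *\<^sub>R Q + y *\<^sub>R R" for x y
    by (simp add: P_def Q_def R_def algebra_simps)
  \<comment> \<open>The short arc has positive length \<open>b - a\<close>, and the bi-Lipschitz
    bound then excludes a vanishing chord.\<close>
  have P: "P \<noteq> 0"
  proof -
    obtain C where C: "0 < C" "intrinsic_dist L f s\<^sub>1 s\<^sub>2 \<le> C * norm P"
      using f(2) by (auto simp: bi_Lipschitz_def P_def)
    have "intrinsic_dist L f s\<^sub>1 s\<^sub>2 = b - a"
      using arc[of 0 0] r arc_length_arclength_param[OF loops(1) f(1) ab']
      by (simp add: intrinsic_dist_short_arc)
    with C ab show ?thesis by auto
  qed
  obtain r' where r': "0 < r'" "\<And>x y. \<bar>x\<bar> < r' \<Longrightarrow> \<bar>y\<bar> < r' \<Longrightarrow> (\<bar>x\<bar> + \<bar>y\<bar>) * (norm Q + norm R) < norm P"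
    using exists_small_radius[of "norm Q + norm R" "norm P"] P by auto
  have chord_pos: "0 < norm (P + x *\<^sub>R Q + y *\<^sub>R R)" if "\<bar>x\<bar> < r'" "\<bar>y\<bar> < r'" for x y
  proof -
    have "norm (x *\<^sub>R Q + y *\<^sub>R R) \<le> \<bar>x\<bar> * norm Q + \<bar>y\<bar> * norm R"
      using norm_triangle_ineq[of "x *\<^sub>R Q" "y *\<^sub>R R"] by simp
    also have "\<dots> \<le> (\<bar>x\<bar> + \<bar>y\<bar>) * (norm Q + norm R)" by (simp add: algebra_simps)
    also have "\<dots> < norm P" by (rule r'(2)[OF that])
    finally have "x *\<^sub>R Q + y *\<^sub>R R \<noteq> - P" by auto
    then have "P + (x *\<^sub>R Q + y *\<^sub>R R) \<noteq> 0" by (metis add.commute eq_neg_iff_add_eq_0)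
    then show ?thesis by (simp add: add.assoc)
  qed
  define q where "q x y = norm (P + x *\<^sub>R Q + y *\<^sub>R R)" for x y
  define D where "D x y = arc_length (?g x y) {a..b}" for x y
  \<comment> \<open>The chord never exceeds the arc; this yields the nonnegativity of
    \<open>m\<close> on a whole neighbourhood, which the power rule at a zero relies on.\<close>
  have qD: "q x y \<le> D x y" for x y
  proof -
    have "periodic L (?g x y)" using g by (simp add: lipschitz_loop_def)
    from norm_diff_le_arc_length[OF g ab', of x y] chord[OF this] show ?thesis
      by (simp only: q_def D_def chord_eq)
  qed
  let ?r = "min r r'"
  have rr: "0 < ?r" using r r'(1) by simp
  have qpos: "0 < q x y" if "\<bar>x\<bar> < ?r" "\<bar>y\<bar> < ?r" for x y
    unfolding q_def by (rule chord_pos) (use that in auto)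
  define m where "m x y = M_a L \<alpha> (?g x y) s\<^sub>1 s\<^sub>2" for x y
  have m_eq: "m x y = q x y powr (- \<alpha>) - D x y powr (- \<alpha>)" if "\<bar>x\<bar> < ?r" "\<bar>y\<bar> < ?r" for x y
  proof -
    have per: "periodic L (?g x y)" using g by (simp add: lipschitz_loop_def)
    have "?g x y s\<^sub>1 - ?g x y s\<^sub>2 \<noteq> 0" unfolding chord_eq using qpos[OF that] by (simp add: q_def)
    then have ne: "?g x y s\<^sub>1 \<noteq> ?g x y s\<^sub>2" by (simp only: right_minus_eq) simp
    have "m x y = 1 / norm (?g x y s\<^sub>1 - ?g x y s\<^sub>2) powr \<alpha> - 1 / arc_length (?g x y) {a..b} powr \<alpha>"
      unfolding m_def by (rule M_a_eq[OF g _ ab' chord[OF per] ne], rule arc) (use that in auto)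
    then show ?thesis by (simp only: chord_eq q_def D_def powr_minus_divide)
  qed
  have m_nonneg: "0 \<le> m x y" if "\<bar>x\<bar> < ?r" "\<bar>y\<bar> < ?r" for x y
    unfolding m_eq[OF that] powr_minus_divide by (rule powr_diff_nonneg[OF qpos[OF that] qD \<alpha>])
  \<comment> \<open>The three values are kept abstract: they are the variations of
    \<open>M_a\<close> themselves, through which the claimed formulas are stated.\<close>
  obtain m\<^sub>1 m\<^sub>2 m\<^sub>1\<^sub>2 where m: "second_order m m\<^sub>1 m\<^sub>2 m\<^sub>1\<^sub>2"
  proof -
    obtain d\<^sub>1 d\<^sub>2 d\<^sub>1\<^sub>2 where d: "second_order D d\<^sub>1 d\<^sub>2 d\<^sub>1\<^sub>2"
      using second_order_arc_length[OF loops f(1) ab'] unfolding D_def by blast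
    have q0: "0 < q 0 0" by (rule qpos) (use rr in auto)
    then have D0: "0 < D 0 0" using qD[of 0 0] by linarith
    obtain e where e: "second_order (\<lambda>x y. D x y powr (- \<alpha>)) (- \<alpha> * D 0 0 powr (- \<alpha> - 1) * d\<^sub>1)
        (\<lambda>x. - \<alpha> * D x 0 powr (- \<alpha> - 1) * d\<^sub>2 x) e"
      using second_order_powr[OF d D0] by blast
    have "second_order q ((P \<bullet> Q) / norm P) (\<lambda>x. ((P + x *\<^sub>R Q) \<bullet> R) / norm (P + x *\<^sub>R Q))
        ((Q \<bullet> R) / norm P - (P \<bullet> Q) * (P \<bullet> R) / norm P ^ 3)"
      unfolding q_def by (rule second_order_norm[OF P])
    from second_order_powr[OF this q0, of "- \<alpha>"] obtain e' where e': "second_order (\<lambda>x y. q x y powr (- \<alpha>))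
        (- \<alpha> * q 0 0 powr (- \<alpha> - 1) * ((P \<bullet> Q) / norm P))
        (\<lambda>x. - \<alpha> * q x 0 powr (- \<alpha> - 1) * (((P + x *\<^sub>R Q) \<bullet> R) / norm (P + x *\<^sub>R Q))) e'"
      by blast
    show thesis
      by (rule that[OF second_order_cong[OF second_order_diff[OF e' e] rr]]) (intro allI impI m_eq[symmetric])
  qed
  have dens: "M_density L \<alpha> p (?g x y) s\<^sub>1 s\<^sub>2 = m x y powr p * line_elt (?g x y) s\<^sub>1 * line_elt (?g x y) s\<^sub>2"
    if "\<bar>x\<bar> < ?r" "\<bar>y\<bar> < ?r" for x y
  proof -
    have "intrinsic_dist L (?g x y) s\<^sub>1 s\<^sub>2 = D x y"
      unfolding intrinsic_dist_short_arc D_def by (subst arc) (use that in auto)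
    then have "M_ap L \<alpha> p (?g x y) s\<^sub>1 s\<^sub>2 = m x y powr p"
      unfolding M_ap_def m_eq[OF that] by (simp only: chord_eq q_def powr_minus_divide)
    then show ?thesis by (simp only: M_density_def)
  qed
  have line: "second_order (\<lambda>x y. line_elt (?g x y) t) (velocity f t \<bullet> velocity \<phi> t)
      (\<lambda>x. ((velocity f t + x *\<^sub>R velocity \<phi> t) \<bullet> velocity \<psi> t) / norm (velocity f t + x *\<^sub>R velocity \<phi> t))
      (velocity \<phi> t \<bullet> velocity \<psi> t - (velocity f t \<bullet> velocity \<phi> t) * (velocity f t \<bullet> velocity \<psi> t))"
    if t: "t \<in> {s\<^sub>1, s\<^sub>2}" for t
  proof -
    have "velocity f t \<noteq> 0" using unit[OF t] by auto
    from second_order_norm[OF this, of "velocity \<phi> t" "velocity \<psi> t"] show ?thesis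
      unfolding line_elt_def velocity_perturb[OF diff(1)[OF t] diff(2)[OF t] diff(3)[OF t]]
      by (simp add: unit[OF t])
  qed
  have line0: "line_elt f t = 1" if "t \<in> {s\<^sub>1, s\<^sub>2}" for t
    using unit[OF that] by (simp add: line_elt_def)
  have mem: "s\<^sub>1 \<in> {s\<^sub>1, s\<^sub>2}" "s\<^sub>2 \<in> {s\<^sub>1, s\<^sub>2}" by simp_all
  have m_pow: "second_order (\<lambda>x y. m x y powr p) (p * rpow (m 0 0) (p - 1) * m\<^sub>1)
      (\<lambda>x. p * (rpow (m x 0) (p - 1) * m\<^sub>2 x))
      (p * (rpow (m 0 0) (p - 1) * m\<^sub>1\<^sub>2 + (p - 1) * rpow (m 0 0) (p - 2) * m\<^sub>1 * m\<^sub>2 0))"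
    by (rule second_order_rpow[OF m p rr]) (rule m_nonneg)
  have dens': "\<forall>x y. \<bar>x\<bar> < ?r \<longrightarrow> \<bar>y\<bar> < ?r \<longrightarrow>
      m x y powr p * line_elt (?g x y) s\<^sub>1 * line_elt (?g x y) s\<^sub>2 = M_density L \<alpha> p (?g x y) s\<^sub>1 s\<^sub>2"
    by (intro allI impI dens[symmetric])
  note var = has_var_if_second_order[OF second_order_cong[OF
      second_order_mult[OF second_order_mult[OF m_pow line[OF mem(1)]] line[OF mem(2)]] rr dens']]
  note var_m = has_var_if_second_order[OF m[unfolded m_def]]
  have m00: "M_a L \<alpha> f s\<^sub>1 s\<^sub>2 = m 0 0" by (simp add: m_def)
  \<comment> \<open>The exponent is not 0, so the convention \<open>0 ^ 0 = 1\<close> does not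
    intervene here, even at a zero of \<open>M_a\<close>.\<close>
  have rp: "rpow t p = t powr p" for t using p by (simp add: rpow_def)
  show ?thesis
  proof (intro conjI)
    show "G_ap L \<alpha> p f \<phi> s\<^sub>1 s\<^sub>2 = G1 L \<alpha> p f \<phi> s\<^sub>1 s\<^sub>2 + G2 L \<alpha> p f \<phi> s\<^sub>1 s\<^sub>2"
      unfolding G_ap_def var(2) G1_def G2_def dM_a_def var_m(2) rp dline_def m00
      by (simp add: line0 unit algebra_simps)
    \<comment> \<open>The coefficient 2 in \<open>H5\<close> has two sources: one copy comes from
      the Hessian of the line element at a unit vector, the other compensates for the terms with
      both factors at the same parameter that the product in \<open>H6\<close> adds.\<close>
    show "H_ap L \<alpha> p f \<phi> \<psi> s\<^sub>1 s\<^sub>2 =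
      H1 L \<alpha> p f \<phi> \<psi> s\<^sub>1 s\<^sub>2 + H2 L \<alpha> p f \<phi> \<psi> s\<^sub>1 s\<^sub>2 + H3 L \<alpha> p f \<phi> \<psi> s\<^sub>1 s\<^sub>2 +
      H4 L \<alpha> p f \<phi> \<psi> s\<^sub>1 s\<^sub>2 + H5 L \<alpha> p f \<phi> \<psi> s\<^sub>1 s\<^sub>2 + H6 L \<alpha> p f \<phi> \<psi> s\<^sub>1 s\<^sub>2"
      unfolding H_ap_def var(6) H1_def H2_def H3_def H4_def H5_def H6_def G1_def dM_a_def ddM_a_def
        var_m(2) var_m(4) var_m(6) rp dline_def m00
      by (simp add: line0 unit algebra_simps)
  qed (rule var_m(1) var_m(3) var_m(5) var(1) var(5))+
qed

section \<open>Almost every pair of parameters\<close>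

lemma AE_lebesgue_pair:
  fixes P :: "real \<Rightarrow> bool"
  assumes P: "AE s in lebesgue. P s"
  shows "AE (s, t) in (lebesgue :: (real \<times> real) measure). P s"
    and "AE (s, t) in (lebesgue :: (real \<times> real) measure). P t"
proof -
  \<comment> \<open>Lebesgue measure on the plane is the completion of the product of the
    Borel-Lebesgue measures. The exceptional set is therefore enlarged to a Borel null set first,
    and the two cylinders over it are null in the product.\<close>
  from P have "AE s in lborel. P s" by (simp only: AE_completion_iff)
  then obtain N where null: "N \<in> null_sets lborel" and sub: "{s \<in> space lborel. \<not> P s} \<subseteq> N"
    unfolding eventually_ae_filter by (rule bexE)
  have N: "P s" if "s \<notin> N" for s using sub that by auto
  have "N \<times> UNIV \<in> null_sets (lborel \<Otimes>\<^sub>M (lborel :: real measure))"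
    by (rule lborel.times_in_null_sets1[OF null]) simp
  then have "AE x in (lborel :: (real \<times> real) measure). x \<notin> N \<times> UNIV"
    unfolding lborel_prod by (rule AE_not_in)
  then show "AE (s, t) in (lebesgue :: (real \<times> real) measure). P s"
    unfolding AE_completion_iff
  proof eventually_elim
    case (elim x)
    then show ?case using N[of "fst x"] by (cases x) simp
  qed
  have "UNIV \<times> N \<in> null_sets ((lborel :: real measure) \<Otimes>\<^sub>M lborel)"
    by (rule lborel.times_in_null_sets2[OF _ null]) simp
  then have "AE x in (lborel :: (real \<times> real) measure). x \<notin> UNIV \<times> N"
    unfolding lborel_prod by (rule AE_not_in)
  then show "AE (s, t) in (lebesgue :: (real \<times> real) measure). P t"
    unfolding AE_completion_iff
  proof eventually_elim
    case (elim x)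
    then show ?case using N[of "snd x"] by (cases x) simp
  qed
qed

text \<open>Countably many lines are removed, each a hyperplane with normal
  \<open>(1, -1)\<close>.\<close>

lemma AE_diff_notin_lattice:
  "AE (s, t) in (lebesgue :: (real \<times> real) measure). \<forall>k::int. s - t \<noteq> of_int k * c"
  unfolding case_prod_beta
proof (rule AE_all_countable[THEN iffD2], rule allI)
  fix k :: int
  have "negligible {x :: real \<times> real. (1, -1) \<bullet> x = of_int k * c}"
    by (rule negligible_hyperplane) (simp add: zero_prod_def)
  then have "{x :: real \<times> real. (1, -1) \<bullet> x = of_int k * c} \<in> null_sets lebesgue"
    by (simp only: negligible_iff_null_sets)
  then have "AE x in (lebesgue :: (real \<times> real) measure). x \<notin> {x. (1, -1) \<bullet> x = of_int k * c}"
    by (rule AE_not_in)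
  then show "AE x in (lebesgue :: (real \<times> real) measure). fst x - snd x \<noteq> of_int k * c"
    by eventually_elim (auto simp: inner_prod_def)
qed

theorem theorem2p1:
  fixes L \<alpha> p \<sigma> :: real
    and f \<phi> \<psi> :: "real \<Rightarrow> real ^ 'n"
  assumes "0 < L" and "0 < \<alpha>" and "1 \<le> p"
    and "2 \<le> \<alpha> * p" and "\<alpha> * p < 2 * p + 1"
    and "\<sigma> = (\<alpha> * p - 1) / (2 * p)"
    and "arclength_param L f" and "non_self_intersecting L f" and "bi_Lipschitz L f"
    and "f \<in> sobolev_slobodeckij L \<sigma> (2 * p) \<inter> sobolev_inf L"
    and "\<phi> \<in> sobolev_slobodeckij L \<sigma> (2 * p) \<inter> sobolev_inf L"
    and "\<psi> \<in> sobolev_slobodeckij L \<sigma> (2 * p) \<inter> sobolev_inf L"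
  shows "AE (s\<^sub>1, s\<^sub>2) in (lebesgue :: (real \<times> real) measure).
    has_var1 (\<lambda>g. M_a L \<alpha> g s\<^sub>1 s\<^sub>2) f \<phi> \<and>
    has_var1 (\<lambda>g. M_a L \<alpha> g s\<^sub>1 s\<^sub>2) f \<psi> \<and>
    has_var2 (\<lambda>g. M_a L \<alpha> g s\<^sub>1 s\<^sub>2) f \<phi> \<psi> \<and>
    has_var1 (\<lambda>g. M_density L \<alpha> p g s\<^sub>1 s\<^sub>2) f \<phi> \<and>
    has_var2 (\<lambda>g. M_density L \<alpha> p g s\<^sub>1 s\<^sub>2) f \<phi> \<psi> \<and>
    G_ap L \<alpha> p f \<phi> s\<^sub>1 s\<^sub>2 = G1 L \<alpha> p f \<phi> s\<^sub>1 s\<^sub>2 + G2 L \<alpha> p f \<phi> s\<^sub>1 s\<^sub>2 \<and>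
    H_ap L \<alpha> p f \<phi> \<psi> s\<^sub>1 s\<^sub>2 =
      H1 L \<alpha> p f \<phi> \<psi> s\<^sub>1 s\<^sub>2 + H2 L \<alpha> p f \<phi> \<psi> s\<^sub>1 s\<^sub>2 + H3 L \<alpha> p f \<phi> \<psi> s\<^sub>1 s\<^sub>2 +
      H4 L \<alpha> p f \<phi> \<psi> s\<^sub>1 s\<^sub>2 + H5 L \<alpha> p f \<phi> \<psi> s\<^sub>1 s\<^sub>2 + H6 L \<alpha> p f \<phi> \<psi> s\<^sub>1 s\<^sub>2"
proof -
  have loops: "lipschitz_loop L f" "lipschitz_loop L \<phi>" "lipschitz_loop L \<psi>"
    using assms(1,10-12) sobolev_inf_lipschitz_loop by auto
  let ?P = "\<lambda>s. (f has_vector_derivative velocity f s) (at s) \<and>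
    (\<phi> has_vector_derivative velocity \<phi> s) (at s) \<and>
    (\<psi> has_vector_derivative velocity \<psi> s) (at s) \<and> norm (velocity f s) = 1"
  have P: "AE s in lebesgue. ?P s"
    using lipschitz_loop_AE_derivative[OF loops(1)] lipschitz_loop_AE_derivative[OF loops(2)]
      lipschitz_loop_AE_derivative[OF loops(3)] AE_norm_velocity[OF assms(7)]
    by eventually_elim (intro conjI)
  show ?thesis
    \<comment> \<open>Spacing \<open>L / 2\<close> removes the pairs that coincide modulo
      \<open>L\<close> together with the antipodal pairs, for which both arcs of the unperturbed
      curve have the same length.\<close>
    using AE_lebesgue_pair(1)[OF P] AE_lebesgue_pair(2)[OF P] AE_diff_notin_lattice[of "L / 2"]
  proof eventually_elim
    case (elim x)
    obtain s\<^sub>1 s\<^sub>2 where x: "x = (s\<^sub>1, s\<^sub>2)" by (cases x)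
    have P12: "?P s\<^sub>1" "?P s\<^sub>2" and "\<And>k::int. s\<^sub>1 - s\<^sub>2 \<noteq> of_int k * (L / 2)"
      using elim by (simp_all add: x)
    moreover have "?P s" if "s \<in> {s\<^sub>1, s\<^sub>2}" for s using that P12 by fastforce
    ultimately show ?case unfolding x prod.case
      by (intro variation_at_regular_point[OF assms(1-3,7,9) loops]) simp_all
  qed
qed

end
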